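(* For every $k$-dimensional linear subspace $E\subset\mathbb{R}^n$ ($1\le k\le n$), the function $$r\mapsto\frac{\gamma_E(E\cap rB_\infty^n)}{\gamma_k(rB_\infty^k)},\qquad r>0,$$ is nonincreasing. In particular, for every $r>0$, $$\gamma_E(E\cap rB_\infty^n)\ge\gamma_k(rB_\infty^k).$$
   Context: $B_\infty^n=[-1,1]^n$. $\gamma_k$ denotes the standard Gaussian probability measure on $\mathbb{R}^k$, and $\gamma_E$ the standard Gaussian probability measure on the subspace $E$ (with the Euclidean structure inherited from $\mathbb{R}^n$). *)

theory Defs
  imports "HOL-Probability.Probability"
begin

definition orthonormal_basis_of :: "'a::euclidean_space set \<Rightarrow> 'a set \<Rightarrow> bool" where
  "orthonormal_basis_of E B \<longleftrightarrow>
     pairwise orthogonal B \<and> (\<forall>b\<in>B. norm b = 1) \<and> span B = E"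

text \<open>
  Lebesgue measure of a linear subspace \<open>E\<close>, as a Borel measure on the ambient space that is
  concentrated on \<open>E\<close>. It is built from an orthonormal basis of \<open>E\<close> in the same way as the library
  builds \<^const>\<open>lborel\<close> from \<^const>\<open>Basis\<close>; by \<open>subspace_lborel_eq_distr\<close> below, the choice
  of the orthonormal basis is immaterial.
\<close>

definition subspace_lborel :: "'a::euclidean_space set \<Rightarrow> 'a measure" where
  "subspace_lborel E =
     (let B = (SOME B. orthonormal_basis_of E B)
      in distr (\<Pi>\<^sub>M b\<in>B. lborel) borel (\<lambda>c. \<Sum>b\<in>B. c b *\<^sub>R b))"

definition std_gaussian :: "'a::euclidean_space measure" where
  "std_gaussian =
     density lborel (\<lambda>x. ennreal (exp (- (norm x)\<^sup>2 / 2) / sqrt (2 * pi) ^ DIM('a)))"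

definition subspace_gaussian :: "'a::euclidean_space set \<Rightarrow> 'a measure" where
  "subspace_gaussian E =
     density (subspace_lborel E) (\<lambda>x. ennreal (exp (- (norm x)\<^sup>2 / 2) / sqrt (2 * pi) ^ dim E))"

definition inf_ball :: "(real ^ 'n) set" where
  "inf_ball = {x. \<forall>i. x $ i \<in> {-1..1}}"

lemma orthonormal_basis_of_exists:
  assumes "subspace E"
  shows "\<exists>B. orthonormal_basis_of E B"
  using orthonormal_basis_subspace[OF assms] unfolding orthonormal_basis_of_def by metis

lemma orthonormal_basis_ofD:
  assumes "orthonormal_basis_of E B"
  shows "finite B" "card B = dim E"
    "\<And>b c. b \<in> B \<Longrightarrow> c \<in> B \<Longrightarrow> b \<bullet> c = (if b = c then 1 else 0)"
    "\<And>x. x \<in> E \<Longrightarrow> (\<Sum>b\<in>B. (x \<bullet> b) *\<^sub>R b) = x"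
proof -
  have po: "pairwise orthogonal B" and n1: "\<And>b. b \<in> B \<Longrightarrow> norm b = 1" and sp: "span B = E"
    using assms by (auto simp: orthonormal_basis_of_def)
  have "0 \<notin> B" using n1 by fastforce
  then have ind: "independent B"
    using po pairwise_orthogonal_independent by blast
  show fin: "finite B" using ind independent_imp_finite by blast
  show "card B = dim E" using ind sp dim_eq_card by fastforce
  show ip: "b \<bullet> c = (if b = c then 1 else 0)" if "b \<in> B" "c \<in> B" for b c
    using that po n1 by (auto simp: pairwise_def orthogonal_def norm_eq_1)
  show "(\<Sum>b\<in>B. (x \<bullet> b) *\<^sub>R b) = x" if "x \<in> E" for x
  proof -
    obtain u where x: "x = (\<Sum>b\<in>B. u b *\<^sub>R b)"
      using \<open>x \<in> E\<close> sp span_finite[OF fin] by auto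
    have "x \<bullet> b = u b" if "b \<in> B" for b
      unfolding x using that fin by (simp add: inner_sum_left ip if_distrib sum.delta' cong: if_cong)
    then show ?thesis by (subst (2) x) simp
  qed
qed

lemma distr_lborel_translation:
  fixes a :: "'a::euclidean_space"
  shows "distr lborel borel (\<lambda>x. a + x) = lborel"
  using lborel_affine[of 1 a] by (simp add: density_1)

lemma distr_lborel_uminus:
  "distr lborel borel uminus = (lborel :: 'a::euclidean_space measure)"
  using lborel_affine[of "-1" "0::'a"] by (simp add: density_1)

lemma distr_lborel_isometry:
  fixes T :: "'a::euclidean_space \<Rightarrow> 'a"
  assumes lin: "linear T" and iso: "\<And>x. norm (T x) = norm x"
  shows "distr lborel borel T = lborel"
proof -
  have [measurable]: "T \<in> borel_measurable borel"
    using lin by (intro borel_measurable_continuous_onI linear_continuous_on linear_conv_bounded_linear[THEN iffD1])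
  define N where "N = distr lborel borel T"
  have sN[measurable_cong]: "sets N = sets borel" by (simp add: N_def)
  have "inj T"
    using lin iso by (metis linear_injective_0 norm_eq_zero)
  then have "surj T"
    using lin linear_injective_imp_surjective by blast
  have preball: "T -` ball 0 r = ball 0 r" for r
    by (auto simp: iso)
  have Nball: "emeasure N (ball 0 r) = emeasure lborel (ball 0 r :: 'a set)" for r
    by (simp add: N_def emeasure_distr preball)
  have fb: "emeasure lborel (ball 0 r :: 'a set) \<noteq> \<infinity>" for r
    using emeasure_lborel_ball_finite[of 0 r] by (simp add: less_top)
  interpret N: sigma_finite_measure N
  proof
    show "\<exists>A. countable A \<and> A \<subseteq> sets N \<and> \<Union> A = space N \<and> (\<forall>a\<in>A. emeasure N a \<noteq> \<infinity>)"
    proof (intro exI[of _ "range (\<lambda>n::nat. ball 0 (real n))"] conjI)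
      show "\<Union> (range (\<lambda>n::nat. ball 0 (real n))) = space N"
        using reals_Archimedean2 by (auto simp: N_def)
    qed (use Nball fb sN in auto)
  qed
  interpret P: pair_sigma_finite N "lborel :: 'a measure" ..
  have Ntr: "distr N borel (\<lambda>x. a + x) = N" for a
  proof -
    obtain c where c: "a = T c" using \<open>surj T\<close> by (metis surjD)
    have "distr N borel (\<lambda>x. a + x) = distr lborel borel (\<lambda>x. a + T x)"
      unfolding N_def by (subst distr_distr) (auto simp: o_def)
    also have "\<dots> = distr lborel borel (\<lambda>x. T (c + x))"
      using lin by (simp add: c linear_add)
    also have "\<dots> = distr (distr lborel borel (\<lambda>x. c + x)) borel T"
      by (subst distr_distr) (auto simp: o_def)
    finally show ?thesis by (simp add: distr_lborel_translation N_def)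
  qed
  have Ntri: "(\<integral>\<^sup>+x. f (a + x) \<partial>N) = (\<integral>\<^sup>+x. f x \<partial>N)" if [measurable]: "f \<in> borel_measurable borel" for f a
    by (subst (2) Ntr[of a, symmetric]) (simp add: nn_integral_distr)
  have Ltri: "(\<integral>\<^sup>+x. f (a + x) \<partial>lborel) = (\<integral>\<^sup>+x. f x \<partial>lborel)"
    if [measurable]: "f \<in> borel_measurable borel" for f :: "'a \<Rightarrow> ennreal" and a
    by (subst (2) distr_lborel_translation[of a, symmetric]) (simp add: nn_integral_distr)
  have Lneg: "(\<integral>\<^sup>+x. f (- x) \<partial>lborel) = (\<integral>\<^sup>+x. f x \<partial>lborel)"
    if [measurable]: "f \<in> borel_measurable borel" for f :: "'a \<Rightarrow> ennreal"
    by (subst (2) distr_lborel_uminus[symmetric]) (simp add: nn_integral_distr)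
  have "N = lborel"
  proof (rule measure_eqI)
    fix A assume "A \<in> sets N"
    then have A[measurable]: "A \<in> sets borel" using sN by simp
    define Q where "Q = (ball 0 1 :: 'a set)"
    have [measurable]: "Q \<in> sets borel" by (simp add: Q_def)
    let ?i = "indicator :: 'a set \<Rightarrow> 'a \<Rightarrow> ennreal"
    have ball_tr: "(\<integral>\<^sup>+y. ?i Q (x + y) \<partial>lborel) = (\<integral>\<^sup>+y. ?i Q y \<partial>lborel)" for x
      by (rule Ltri) measurable
    have "emeasure N A * emeasure lborel Q = (\<integral>\<^sup>+x. ?i A x * (\<integral>\<^sup>+y. ?i Q y \<partial>lborel) \<partial>N)"
      by (simp add: nn_integral_multc)
    also have "\<dots> = (\<integral>\<^sup>+x. ?i A x * (\<integral>\<^sup>+y. ?i Q (x + y) \<partial>lborel) \<partial>N)"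
      by (simp only: ball_tr)
    also have "\<dots> = (\<integral>\<^sup>+x. (\<integral>\<^sup>+y. ?i A x * ?i Q (x + y) \<partial>lborel) \<partial>N)"
      by (intro nn_integral_cong nn_integral_cmult[symmetric]) measurable
    also have "\<dots> = (\<integral>\<^sup>+y. (\<integral>\<^sup>+x. ?i A x * ?i Q (x + y) \<partial>N) \<partial>lborel)"
      by (intro P.Fubini'[symmetric]) measurable
    also have "\<dots> = (\<integral>\<^sup>+y. (\<integral>\<^sup>+x. ?i A (- y + x) * ?i Q x \<partial>N) \<partial>lborel)"
    proof (rule nn_integral_cong)
      fix y :: 'a
      show "(\<integral>\<^sup>+x. ?i A x * ?i Q (x + y) \<partial>N) = (\<integral>\<^sup>+x. ?i A (- y + x) * ?i Q x \<partial>N)"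
        using Ntri[of "\<lambda>x. ?i A (- y + x) * ?i Q x" y] by (simp add: add.commute)
    qed
    also have "\<dots> = (\<integral>\<^sup>+x. (\<integral>\<^sup>+y. ?i A (- y + x) * ?i Q x \<partial>lborel) \<partial>N)"
      by (intro P.Fubini') measurable
    also have "\<dots> = (\<integral>\<^sup>+x. (\<integral>\<^sup>+y. ?i A y \<partial>lborel) * ?i Q x \<partial>N)"
    proof (rule nn_integral_cong)
      fix x :: 'a
      have "(\<integral>\<^sup>+y. ?i A (- y + x) * ?i Q x \<partial>lborel) = (\<integral>\<^sup>+y. ?i A (- y + x) \<partial>lborel) * ?i Q x"
        by (rule nn_integral_multc) measurable
      also have "(\<integral>\<^sup>+y. ?i A (- y + x) \<partial>lborel) = (\<integral>\<^sup>+y. ?i A (x + y) \<partial>lborel)"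
        by (subst Lneg[of "\<lambda>y. ?i A (y + x)"]) (simp_all add: add.commute)
      also have "\<dots> = (\<integral>\<^sup>+y. ?i A y \<partial>lborel)" by (rule Ltri) measurable
      finally show "(\<integral>\<^sup>+y. ?i A (- y + x) * ?i Q x \<partial>lborel) = (\<integral>\<^sup>+y. ?i A y \<partial>lborel) * ?i Q x" .
    qed
    also have "\<dots> = emeasure lborel A * emeasure N Q"
      by (simp add: nn_integral_cmult sN)
    finally have "emeasure lborel Q * emeasure N A = emeasure lborel Q * emeasure lborel A"
      by (simp add: Nball Q_def mult.commute)
    moreover have "emeasure lborel Q \<noteq> 0"
      using emeasure_lborel_ball_finite[of "0::'a" 1] content_ball_pos[of 1 "0::'a"]
      by (auto simp: measure_def Q_def)
    ultimately show "emeasure N A = emeasure lborel A"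
      using fb by (simp add: Q_def ennreal_mult_cancel_left)
  qed (simp add: sN)
  then show ?thesis by (simp add: N_def)
qed

lemma subspace_lborel_eq_distr:
  fixes f :: "'b::euclidean_space \<Rightarrow> 'a::euclidean_space"
  assumes lin: "linear f" and iso: "\<And>x. norm (f x) = norm x" and E: "range f = E"
  shows "subspace_lborel E = distr lborel borel f"
proof -
  have [measurable]: "f \<in> borel_measurable borel"
    using lin by (intro borel_measurable_continuous_onI linear_continuous_on linear_conv_bounded_linear[THEN iffD1])
  have "subspace E"
    using lin E linear_subspace_image subspace_UNIV by blast
  define B where "B = (SOME B. orthonormal_basis_of E B)"
  have B: "orthonormal_basis_of E B"
    unfolding B_def using orthonormal_basis_of_exists[OF \<open>subspace E\<close>] by (rule someI_ex)
  note BD = orthonormal_basis_ofD[OF B]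
  have "inj f"
    using lin iso by (metis linear_injective_0 norm_eq_zero)
  then have "dim E = DIM('b)"
    using dim_image_eq[OF lin, of UNIV] E by (simp add: dim_UNIV)
  then obtain h where h: "bij_betw h B (Basis :: 'b set)"
    using BD(1,2) finite_same_card_bij[of B "Basis :: 'b set"] by auto
  have hB: "h b \<in> Basis" if "b \<in> B" for b
    using h that by (auto simp: bij_betw_def)
  have hip: "h b \<bullet> h c = (if b = c then 1 else 0)" if "b \<in> B" "c \<in> B" for b c
    using that hB h by (auto simp: inner_Basis bij_betw_def inj_on_def)
  have hsum: "(\<Sum>b\<in>B. c b * (h b \<bullet> h b')) = c b'" if "b' \<in> B" for c :: "'a \<Rightarrow> real" and b'
    using that BD(1) by (simp add: hip if_distrib cong: if_cong)
  define s where "s c = (\<Sum>b\<in>B. c b *\<^sub>R h b)" for c :: "'a \<Rightarrow> real"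
  define g where "g x = (\<Sum>b\<in>B. (x \<bullet> h b) *\<^sub>R b)" for x :: 'b
  define u where "u x = s (\<lambda>b. f x \<bullet> b)" for x :: 'b
  interpret product_sigma_finite "\<lambda>_::'a. lborel :: real measure" ..
  have [measurable]: "s \<in> borel_measurable (\<Pi>\<^sub>M b\<in>B. lborel)"
    unfolding s_def by measurable
  have [measurable]: "g \<in> borel_measurable borel"
    unfolding g_def by measurable
  have [measurable]: "u \<in> borel_measurable borel"
    unfolding u_def s_def by measurable
  have sinner: "s c \<bullet> h b = c b" if "b \<in> B" for c b
    using hsum[OF that] by (simp add: s_def inner_sum_left)
  have lb: "lborel = distr (\<Pi>\<^sub>M b\<in>B. lborel) borel s"
  proof (rule lborel_eqI)
    fix l v :: 'b assume le: "\<And>b. b \<in> Basis \<Longrightarrow> l \<bullet> b \<le> v \<bullet> b"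
    have *: "(\<forall>i\<in>Basis. P i) \<longleftrightarrow> (\<forall>b\<in>B. P (h b))" for P :: "'b \<Rightarrow> bool"
      using h unfolding bij_betw_def by (metis (no_types) imageE imageI)
    have "s -` box l v \<inter> space (\<Pi>\<^sub>M b\<in>B. lborel) = (\<Pi>\<^sub>E b\<in>B. {l \<bullet> h b<..<v \<bullet> h b})"
      by (auto simp: box_def * sinner space_PiM PiE_iff)
    then have "emeasure (distr (\<Pi>\<^sub>M b\<in>B. lborel) borel s) (box l v)
        = (\<Prod>b\<in>B. emeasure lborel {l \<bullet> h b<..<v \<bullet> h b})"
      using BD(1) by (simp add: emeasure_distr emeasure_PiM)
    also have "\<dots> = (\<Prod>b\<in>B. ennreal ((v - l) \<bullet> h b))"
      using le hB by (intro prod.cong) (auto simp: inner_diff_left)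
    also have "\<dots> = (\<Prod>b\<in>Basis. ennreal ((v - l) \<bullet> b))"
      by (rule prod.reindex_bij_betw[OF h])
    also have "\<dots> = ennreal (\<Prod>b\<in>Basis. (v - l) \<bullet> b)"
      using le by (intro prod_ennreal) (auto simp: inner_diff_left)
    finally show "emeasure (distr (\<Pi>\<^sub>M b\<in>B. lborel) borel s) (box l v)
        = ennreal (\<Prod>b\<in>Basis. (v - l) \<bullet> b)" .
  qed simp
  have gs: "g (s c) = (\<Sum>b\<in>B. c b *\<^sub>R b)" for c
    by (simp add: g_def sinner)
  have gu: "g (u x) = f x" for x
    unfolding u_def gs using BD(4)[of "f x"] E by auto
  have "linear u"
    unfolding u_def s_def
    by (rule linearI) (simp_all add: linear_add[OF lin] linear_cmul[OF lin] inner_add_left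
        scaleR_add_left sum.distrib scaleR_sum_right)
  have "norm (u x) = norm x" for x
  proof -
    have "u x \<bullet> u x = (\<Sum>b\<in>B. (f x \<bullet> b) * (f x \<bullet> b))"
      unfolding u_def by (subst (2) s_def) (simp add: inner_sum_right sinner)
    also have "\<dots> = f x \<bullet> (\<Sum>b\<in>B. (f x \<bullet> b) *\<^sub>R b)"
      by (simp add: inner_sum_right)
    also have "\<dots> = f x \<bullet> f x"
      using BD(4)[of "f x"] E by auto
    finally show ?thesis using iso[of x] by (simp add: norm_eq_sqrt_inner)
  qed
  then have "distr lborel borel u = lborel"
    using \<open>linear u\<close> by (rule distr_lborel_isometry[rotated])
  have "subspace_lborel E = distr (\<Pi>\<^sub>M b\<in>B. lborel) borel (\<lambda>c. g (s c))"
    by (simp add: subspace_lborel_def Let_def B_def[symmetric] gs)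
  also have "\<dots> = distr (distr (\<Pi>\<^sub>M b\<in>B. lborel) borel s) borel g"
    by (subst distr_distr) (auto simp: o_def)
  also have "\<dots> = distr (distr lborel borel u) borel g"
    by (simp add: lb[symmetric] \<open>distr lborel borel u = lborel\<close>)
  also have "\<dots> = distr lborel borel f"
    by (subst distr_distr) (auto simp: o_def gu)
  finally show ?thesis .
qed

lemma subspace_gaussian_eq_distr:
  fixes f :: "'b::euclidean_space \<Rightarrow> 'a::euclidean_space"
  assumes lin: "linear f" and iso: "\<And>x. norm (f x) = norm x" and E: "range f = E"
  shows "subspace_gaussian E = distr std_gaussian borel f"
proof -
  have [measurable]: "f \<in> borel_measurable borel"
    using lin by (intro borel_measurable_continuous_onI linear_continuous_on linear_conv_bounded_linear[THEN iffD1])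
  have "inj f"
    using lin iso by (metis linear_injective_0 norm_eq_zero)
  then have d: "dim E = DIM('b)"
    using dim_image_eq[OF lin, of UNIV] E by (simp add: dim_UNIV)
  show ?thesis
    unfolding subspace_gaussian_def std_gaussian_def subspace_lborel_eq_distr[OF assms] d
    by (subst density_distr) (simp_all add: iso)
qed

lemma prob_space_std_gaussian: "prob_space (std_gaussian :: 'a::euclidean_space measure)"
proof
  have "exp (- (norm x)\<^sup>2 / 2) / sqrt (2 * pi) ^ DIM('a) = (\<Prod>b\<in>Basis. std_normal_density (x \<bullet> b))" for x :: 'a
  proof -
    have "(norm x)\<^sup>2 = (\<Sum>b\<in>Basis. (x \<bullet> b)\<^sup>2)"
      by (subst power2_norm_eq_inner, subst euclidean_inner) (simp add: power2_eq_square)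
    then have "- (norm x)\<^sup>2 / 2 = (\<Sum>b\<in>Basis. - (x \<bullet> b)\<^sup>2 / 2)"
      by (simp add: sum_negf sum_divide_distrib)
    then show ?thesis
      by (simp only: exp_sum[OF finite_Basis] std_normal_density_def prod.distrib prod_constant)
        (simp add: power_divide)
  qed
  then have "emeasure std_gaussian (space std_gaussian :: 'a set)
      = (\<integral>\<^sup>+x. (\<Prod>b\<in>(Basis :: 'a set). ennreal (std_normal_density (x \<bullet> b))) \<partial>lborel)"
    by (simp add: std_gaussian_def emeasure_density prod_ennreal)
  also have "\<dots> = (\<Prod>b\<in>(Basis :: 'a set). (\<integral>\<^sup>+x. ennreal (std_normal_density x) \<partial>lborel))"
    by (rule nn_integral_lborel_prod) auto
  also have "(\<integral>\<^sup>+x. ennreal (std_normal_density x) \<partial>lborel) = 1"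
    using prob_space.emeasure_space_1[OF prob_space_normal_density[of 1 0]]
    by (simp add: emeasure_density)
  finally show "emeasure std_gaussian (space std_gaussian :: 'a set) = 1" by simp
qed

end

theory Submission
  imports Defs
begin

text \<open>
  Let \<open>\<phi>\<^sub>r t = exp (- t\<^sup>2 / 2)\<close> on \<open>[- r, r]\<close> (and \<open>0\<close> outside), \<open>w\<^sub>r = \<integral> \<phi>\<^sub>r\<close> and
  \<open>\<psi>\<^sub>r t = \<phi>\<^sub>r (w\<^sub>r t)\<close>. Write \<open>a\<^sub>i\<close> for the projections of the standard basis vectors to \<open>E\<close>. Since
  \<open>\<Sum>\<^sub>i (a\<^sub>i \<bullet> x)\<^sup>2 = |x|\<^sup>2\<close> on \<open>E\<close>, substituting \<open>x = w\<^sub>r z\<close> shows that the quotient in question equals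
  \<open>\<integral>\<^sub>E \<Prod>\<^sub>i \<psi>\<^sub>r (a\<^sub>i \<bullet> z) dz\<close>. For \<open>r \<le> s\<close> the functions \<open>\<psi>\<^sub>r\<close> and \<open>\<psi>\<^sub>s\<close> have the same integral, and
  \<open>\<psi>\<^sub>s \<le> \<psi>\<^sub>r\<close> until \<open>\<psi>\<^sub>r\<close> drops to \<open>0\<close>; so \<open>\<psi>\<^sub>r\<close> has the larger integral against every even
  function that decreases away from \<open>0\<close>. By the Prekopa-Leindler inequality the integral of the
  other factors over the hyperplanes orthogonal to \<open>a\<^sub>i\<close> is such a function, and the factors
  \<open>\<psi>\<^sub>s\<close> can be replaced by \<open>\<psi>\<^sub>r\<close> one at a time (Kanter's argument). The inequality without the
  quotient on the right follows because the quotient tends to \<open>1\<close> at infinity.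
\<close>

section \<open>The Prekopa-Leindler inequality\<close>

lemma emeasure_lborel_affine_vimage:
  fixes A :: "real set"
  assumes [measurable]: "A \<in> sets borel" and "c \<noteq> 0"
  shows "emeasure lborel A = ennreal \<bar>c\<bar> * emeasure lborel ((\<lambda>x. t + c * x) -` A)"
proof -
  have m: "(\<lambda>x. t + c * x) -` A \<in> sets borel"
    using measurable_sets[of "\<lambda>x. t + c * x" borel borel A] by simp
  have "emeasure lborel A = (\<integral>\<^sup>+x. indicator A x \<partial>lborel)" by simp
  also have "\<dots> = ennreal \<bar>c\<bar> * (\<integral>\<^sup>+x. indicator A (t + c * x) \<partial>lborel)"
    using nn_integral_real_affine[of "indicator A" c t] assms(2) by simp
  also have "(\<lambda>x. indicator A (t + c * x) :: ennreal) = indicator ((\<lambda>x. t + c * x) -` A)"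
    by (auto simp: fun_eq_iff indicator_def)
  finally show ?thesis using m by simp
qed

text \<open>Translates \<open>A + b\<close> and \<open>a + B\<close> with \<open>a\<close> close to \<open>Sup A\<close> and \<open>b\<close> close to \<open>Inf B\<close> both lie
  in \<open>S\<close> and overlap only in a short interval.\<close>

lemma brunn_minkowski_real_bounded:
  fixes A B S :: "real set"
  assumes [measurable]: "A \<in> sets borel" "B \<in> sets borel" "S \<in> sets borel"
    and ne: "A \<noteq> {}" "B \<noteq> {}" and bdd: "bdd_above A" "bdd_below B"
    and sum: "\<And>a b. a \<in> A \<Longrightarrow> b \<in> B \<Longrightarrow> a + b \<in> S"
  shows "emeasure lborel A + emeasure lborel B \<le> emeasure lborel S"
proof (rule ennreal_le_epsilon)
  fix e :: real assume "e > 0"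
  obtain a where a: "a \<in> A" "Sup A - e / 2 < a"
    using less_cSup_iff[OF ne(1) bdd(1), of "Sup A - e / 2"] \<open>e > 0\<close> by auto
  obtain b where b: "b \<in> B" "b < Inf B + e / 2"
    using cInf_less_iff[OF ne(2) bdd(2), of "Inf B + e / 2"] \<open>e > 0\<close> by auto
  define A' where "A' = (\<lambda>x. - b + 1 * x) -` A"
  define B' where "B' = (\<lambda>x. - a + 1 * x) -` B"
  have [measurable]: "A' \<in> sets borel" "B' \<in> sets borel"
    using measurable_sets[of "\<lambda>x. - b + 1 * x" borel borel A]
      measurable_sets[of "\<lambda>x. - a + 1 * x" borel borel B] by (auto simp: A'_def B'_def)
  have sub: "A' \<union> B' \<subseteq> S"
    using sum[OF _ b(1)] sum[OF a(1)] by (force simp: A'_def B'_def)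
  have "A' \<inter> B' \<subseteq> {a + Inf B .. Sup A + b}"
    using cSup_upper[OF _ bdd(1)] cInf_lower[OF _ bdd(2)] by (force simp: A'_def B'_def)
  then have "emeasure lborel (A' \<inter> B') \<le> emeasure lborel {a + Inf B .. Sup A + b}"
    by (intro emeasure_mono) auto
  also have "\<dots> \<le> ennreal e"
    using a b by (cases "a + Inf B \<le> Sup A + b") (auto intro!: ennreal_leI)
  finally have int: "emeasure lborel (A' \<inter> B') \<le> ennreal e" .
  have "emeasure lborel A + emeasure lborel B = emeasure lborel A' + emeasure lborel B'"
    using emeasure_lborel_affine_vimage[of A 1 "- b"] emeasure_lborel_affine_vimage[of B 1 "- a"]
    by (simp add: A'_def B'_def)
  also have "\<dots> = emeasure lborel (A' \<union> B') + emeasure lborel (A' \<inter> B')"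
    by (rule emeasure_Un_Int) auto
  also have "\<dots> \<le> emeasure lborel S + ennreal e"
    using sub int by (intro add_mono emeasure_mono) auto
  finally show "emeasure lborel A + emeasure lborel B \<le> emeasure lborel S + ennreal e" .
qed

lemma incseq_emeasure_lborel:
  "range A \<subseteq> sets borel \<Longrightarrow> incseq A \<Longrightarrow> incseq (\<lambda>n. emeasure lborel (A n))"
  by (rule incseq_SucI, rule emeasure_mono) (auto dest: incseq_SucD)

text \<open>Cutting \<open>A\<close> off on the right and \<open>B\<close> off on the left makes the
  bounded case applicable, and both measures are recovered as increasing limits.\<close>

lemma brunn_minkowski_real:
  fixes A B S :: "real set"
  assumes [measurable]: "A \<in> sets borel" "B \<in> sets borel" "S \<in> sets borel"
    and ne: "A \<noteq> {}" "B \<noteq> {}"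
    and sum: "\<And>a b. a \<in> A \<Longrightarrow> b \<in> B \<Longrightarrow> a + b \<in> S"
  shows "emeasure lborel A + emeasure lborel B \<le> emeasure lborel S"
proof -
  obtain a b where ab: "a \<in> A" "b \<in> B" using ne by auto
  \<comment> \<open>The offset \<open>k\<close> keeps the witnesses \<open>a\<close> and
    \<open>b\<close> in every truncation, already at \<open>n = 0\<close>, so that no truncated set
    is empty.\<close>
  obtain k :: nat where k: "\<bar>a\<bar> + \<bar>b\<bar> \<le> real k" using real_arch_simple by blast
  define A' where "A' n = A \<inter> {..real (n + k)}" for n
  define B' where "B' n = B \<inter> {- real (n + k)..}" for n
  have [measurable]: "A' n \<in> sets borel" "B' n \<in> sets borel" for n by (auto simp: A'_def B'_def)
  have ne': "A' n \<noteq> {}" "B' n \<noteq> {}" for n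
  proof -
    have "a \<in> A' n" "b \<in> B' n" using ab k by (auto simp: A'_def B'_def)
    then show "A' n \<noteq> {}" "B' n \<noteq> {}" by auto
  qed
  have UA: "(\<Union>n. A' n) = A"
  proof (auto simp: A'_def)
    fix x obtain n :: nat where "x \<le> real n" using real_arch_simple by blast
    then show "\<exists>n. x \<le> real n + real k" by (intro exI[of _ n]) auto
  qed
  have UB: "(\<Union>n. B' n) = B"
  proof (auto simp: B'_def)
    fix x obtain n :: nat where "- x \<le> real n" using real_arch_simple by blast
    then show "\<exists>n. - real n - real k \<le> x" by (intro exI[of _ n]) auto
  qed
  have inc: "incseq A'" "incseq B'" by (auto simp: incseq_def A'_def B'_def)
  have "(SUP n. emeasure lborel (A' n)) = emeasure lborel A"
    by (subst SUP_emeasure_incseq) (simp_all add: image_subset_iff inc UA)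
  moreover have "(SUP n. emeasure lborel (B' n)) = emeasure lborel B"
    by (subst SUP_emeasure_incseq) (simp_all add: image_subset_iff inc UB)
  moreover have "(SUP n. emeasure lborel (A' n)) + (SUP n. emeasure lborel (B' n))
      = (SUP n. emeasure lborel (A' n) + emeasure lborel (B' n))"
    by (rule ennreal_SUP_add[symmetric]; rule incseq_emeasure_lborel) (auto simp: inc)
  moreover have "(SUP n. emeasure lborel (A' n) + emeasure lborel (B' n)) \<le> emeasure lborel S"
    by (intro SUP_least brunn_minkowski_real_bounded ne' sum) (auto simp: A'_def B'_def)
  ultimately show ?thesis by simp
qed

text \<open>Reduces to the plain sum by dilation: the preimages \<open>A'\<close> and
  \<open>B'\<close> are the sets \<open>l * A\<close> and \<open>(1 - l) * B\<close>.\<close>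

lemma brunn_minkowski_real_convex:
  fixes A B S :: "real set"
  assumes [measurable]: "A \<in> sets borel" "B \<in> sets borel" "S \<in> sets borel"
    and ne: "A \<noteq> {}" "B \<noteq> {}" and l: "0 < l" "l < 1"
    and sum: "\<And>a b. a \<in> A \<Longrightarrow> b \<in> B \<Longrightarrow> l * a + (1 - l) * b \<in> S"
  shows "ennreal l * emeasure lborel A + ennreal (1 - l) * emeasure lborel B \<le> emeasure lborel S"
proof -
  define A' where "A' = (\<lambda>x. 0 + (1 / l) * x) -` A"
  define B' where "B' = (\<lambda>x. 0 + (1 / (1 - l)) * x) -` B"
  have m[measurable]: "A' \<in> sets borel" "B' \<in> sets borel"
    using measurable_sets[of "\<lambda>x. 0 + (1 / l) * x" borel borel A]
      measurable_sets[of "\<lambda>x. 0 + (1 / (1 - l)) * x" borel borel B] by (auto simp: A'_def B'_def)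
  have A: "ennreal l * emeasure lborel A = emeasure lborel A'"
    using emeasure_lborel_affine_vimage[of A "1 / l" 0] l
    by (simp add: A'_def mult.assoc[symmetric] ennreal_mult[symmetric])
  have B: "ennreal (1 - l) * emeasure lborel B = emeasure lborel B'"
    using emeasure_lborel_affine_vimage[of B "1 / (1 - l)" 0] l
    by (simp add: B'_def mult.assoc[symmetric] ennreal_mult[symmetric])
  obtain a b where ab: "a \<in> A" "b \<in> B" using ne by auto
  have "l * a \<in> A'" "(1 - l) * b \<in> B'" using ab l by (auto simp: A'_def B'_def)
  then have ne': "A' \<noteq> {}" "B' \<noteq> {}" by auto
  have "x + y \<in> S" if "x \<in> A'" "y \<in> B'" for x y
    using sum[of "x / l" "y / (1 - l)"] that l by (simp add: A'_def B'_def)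
  then show ?thesis
    unfolding A B by (intro brunn_minkowski_real m assms(3) ne')
qed

section \<open>From level sets to integrals\<close>

lemma nn_integral_layer_cake:
  fixes F :: "'a \<Rightarrow> ennreal"
  assumes "sigma_finite_measure M" and [measurable]: "F \<in> borel_measurable M"
  shows "(\<integral>\<^sup>+x. F x \<partial>M)
    = (\<integral>\<^sup>+s. indicator {0<..} s * emeasure M {x \<in> space M. ennreal s < F x} \<partial>lborel)"
proof -
  interpret sigma_finite_measure M by fact
  interpret P: pair_sigma_finite "lborel :: real measure" M ..
  \<comment> \<open>Each value \<open>y\<close> is the length of the set of heights strictly between
    \<open>0\<close> and \<open>y\<close>. Substituting this for \<open>F x\<close> and exchanging
    the integrals gives the formula, infinite values included.\<close>
  have len: "(\<integral>\<^sup>+s. indicator {s. 0 < s \<and> ennreal s < y} s \<partial>lborel) = y" for y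
  proof (cases y)
    case (real r)
    then have "{s. 0 < s \<and> ennreal s < y} = {0<..<r}"
      by (auto simp: ennreal_less_iff)
    then show ?thesis using real by simp
  next
    case top
    then have "{s. 0 < s \<and> ennreal s < y} = {0<..}" by auto
    moreover have "emeasure lborel {0::real<..} = top"
    proof (rule ccontr)
      assume "emeasure lborel {0::real<..} \<noteq> top"
      then obtain r where r: "r \<ge> 0" "emeasure lborel {0::real<..} = ennreal r"
        by (cases "emeasure lborel {0::real<..}") auto
      have "emeasure lborel {0<..<r + 1} \<le> emeasure lborel {0::real<..}"
        by (intro emeasure_mono) auto
      then show False using r by simp
    qed
    ultimately show ?thesis using top by simp
  qed
  have "(\<integral>\<^sup>+x. F x \<partial>M) = (\<integral>\<^sup>+x. (\<integral>\<^sup>+s. indicator {s. 0 < s \<and> ennreal s < F x} s \<partial>lborel) \<partial>M)"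
    by (simp only: len)
  also have "\<dots> = (\<integral>\<^sup>+x. (\<integral>\<^sup>+s. indicator {(s, x). 0 < s \<and> ennreal s < F x} (s, x) \<partial>lborel) \<partial>M)"
    by (intro nn_integral_cong) (auto simp: indicator_def)
  also have "\<dots> = (\<integral>\<^sup>+s. (\<integral>\<^sup>+x. indicator {(s, x). 0 < s \<and> ennreal s < F x} (s, x) \<partial>M) \<partial>lborel)"
    by (rule P.Fubini') measurable
  also have "\<dots> = (\<integral>\<^sup>+s. indicator {0<..} s * emeasure M {x \<in> space M. ennreal s < F x} \<partial>lborel)"
  proof (rule nn_integral_cong)
    fix s :: real
    have "(\<integral>\<^sup>+x. indicator {(s, x). 0 < s \<and> ennreal s < F x} (s, x) \<partial>M)
      = (\<integral>\<^sup>+x. indicator {0<..} s * indicator {x \<in> space M. ennreal s < F x} x \<partial>M)"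
      by (intro nn_integral_cong) (auto simp: indicator_def)
    then show "(\<integral>\<^sup>+x. indicator {(s, x). 0 < s \<and> ennreal s < F x} (s, x) \<partial>M)
      = indicator {0<..} s * emeasure M {x \<in> space M. ennreal s < F x}"
      by (simp add: nn_integral_cmult)
  qed
  finally show ?thesis .
qed

text \<open>Below height 1 the superlevel sets of \<open>f\<close> and \<open>g\<close> are both
  nonempty, so the inequality for sets applies level by level; from height 1 on both are empty. The
  layer-cake formula sums this up. The common supremum 1 is what makes the levels match.\<close>

lemma brunn_minkowski_real_nn_integral:
  fixes f g h :: "real \<Rightarrow> ennreal"
  assumes [measurable]: "f \<in> borel_measurable borel" "g \<in> borel_measurable borel" "h \<in> borel_measurable borel"
    and l: "0 < l" "l < 1"
    and le1: "\<And>x. f x \<le> 1" "\<And>x. g x \<le> 1"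
    and ne: "\<And>s. 0 < s \<Longrightarrow> s < 1 \<Longrightarrow> \<exists>x. ennreal s < f x" "\<And>s. 0 < s \<Longrightarrow> s < 1 \<Longrightarrow> \<exists>x. ennreal s < g x"
    and h: "\<And>s x y. 0 < s \<Longrightarrow> ennreal s < f x \<Longrightarrow> ennreal s < g y \<Longrightarrow> ennreal s \<le> h (l * x + (1 - l) * y)"
  shows "ennreal l * (\<integral>\<^sup>+x. f x \<partial>lborel) + ennreal (1 - l) * (\<integral>\<^sup>+x. g x \<partial>lborel) \<le> (\<integral>\<^sup>+x. h x \<partial>lborel)"
proof -
  define D where "D F s = indicator {0<..} s * emeasure lborel {x. ennreal s < F x}"
    for F :: "real \<Rightarrow> ennreal" and s :: real
  have D: "(\<integral>\<^sup>+x. F x \<partial>lborel) = (\<integral>\<^sup>+s. D F s \<partial>lborel)" if "F \<in> borel_measurable borel" for F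
    using nn_integral_layer_cake[OF lborel.sigma_finite_measure_axioms, of F] that by (simp add: D_def)
  have Dm: "D F \<in> borel_measurable borel" if [measurable]: "F \<in> borel_measurable borel" for F
  proof -
    \<comment> \<open>The region below the graph is a measurable subset of the plane, so the measure
      of its sections depends measurably on the height.\<close>
    have "{z \<in> space (borel \<Otimes>\<^sub>M lborel). ennreal (fst z) < F (snd z)} \<in> sets (borel \<Otimes>\<^sub>M lborel)"
      by measurable
    from lborel.measurable_emeasure_Pair[OF this] show ?thesis
      unfolding D_def by (simp add: space_pair_measure vimage_def)
  qed
  have le: "ennreal l * D f s + ennreal (1 - l) * D g s \<le> D h s" for s
  proof (cases "0 < s \<and> s < 1")
    case True
    have "ennreal s < h (l * x + (1 - l) * y)" if fg: "ennreal s < f x" "ennreal s < g y" for x y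
    proof -
      \<comment> \<open>The hypothesis on \<open>h\<close> yields only a weak inequality, but
        superlevel sets are strict; it is therefore applied at a height \<open>t'\<close> slightly
        above \<open>s\<close>.\<close>
      obtain t where t: "ennreal s < t" "t < min (f x) (g y)"
        using dense[of "ennreal s" "min (f x) (g y)"] fg by auto
      then obtain t' where t': "t = ennreal t'" "0 < t'" "s < t'"
        using True by (cases t) (auto simp: ennreal_less_iff)
      have "ennreal s < ennreal t'" using t t' by simp
      also have "ennreal t' \<le> h (l * x + (1 - l) * y)" using h[of t' x y] t t' by auto
      finally show ?thesis .
    qed
    then have "ennreal l * emeasure lborel {x. ennreal s < f x} + ennreal (1 - l) * emeasure lborel {x. ennreal s < g x}
        \<le> emeasure lborel {x. ennreal s < h x}"
      using ne[of s] True l by (intro brunn_minkowski_real_convex) auto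
    then show ?thesis using True by (simp add: D_def)
  next
    case False
    show ?thesis
    proof (cases "0 < s")
      case True
      then have "1 \<le> ennreal s" using False ennreal_leI[of 1 s] by simp
      then have "{x. ennreal s < f x} = {}" "{x. ennreal s < g x} = {}"
        using order_trans[OF le1(1)] order_trans[OF le1(2)] by (simp_all add: not_less)
      then show ?thesis by (simp add: D_def)
    qed (simp add: D_def)
  qed
  have "(\<integral>\<^sup>+s. ennreal l * D f s + ennreal (1 - l) * D g s \<partial>lborel) \<le> (\<integral>\<^sup>+s. D h s \<partial>lborel)"
    by (rule nn_integral_mono) (rule le)
  then show ?thesis
    by (simp only: D[OF assms(1)] D[OF assms(2)] D[OF assms(3)] nn_integral_add nn_integral_cmult
        Dm[OF assms(1)] Dm[OF assms(2)] borel_measurable_const borel_measurable_times_ennreal measurable_lborel2)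
qed

text \<open>States \<open>U powr l * V powr (1 - l) \<le> W\<close> for extended reals, on which \<open>powr\<close> is not
  available.\<close>

definition geo_le :: "real \<Rightarrow> ennreal \<Rightarrow> ennreal \<Rightarrow> ennreal \<Rightarrow> bool" where
  "geo_le l U V W \<longleftrightarrow> (\<forall>a b. 0 < a \<longrightarrow> 0 < b \<longrightarrow> ennreal a < U \<longrightarrow> ennreal b < V \<longrightarrow>
     ennreal (a powr l * b powr (1 - l)) \<le> W)"

lemma geo_leD: "geo_le l U V W \<Longrightarrow> 0 < a \<Longrightarrow> 0 < b \<Longrightarrow> ennreal a < U \<Longrightarrow> ennreal b < V \<Longrightarrow>
    ennreal (a powr l * b powr (1 - l)) \<le> W"
  by (auto simp: geo_le_def)

text \<open>The weighted geometric mean of \<open>a\<close> with itself is \<open>a\<close>, and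
  \<open>U\<close> is the supremum of the values strictly below it.\<close>

lemma geo_le_same: "geo_le l U U W \<Longrightarrow> U \<le> W"
proof (rule dense_le)
  fix x assume g: "geo_le l U U W" and x: "x < U"
  then obtain a where a: "x = ennreal a" "a \<ge> 0" by (cases x) auto
  show "x \<le> W"
  proof (cases "a = 0")
    case False
    then show ?thesis
      using geo_leD[OF g, of a a] a x by (simp add: powr_add[symmetric])
  qed (use a in simp)
qed

text \<open>Monotone convergence. It provides bounded functions, whose finite suprema can serve as
  normalizing constants in the Prekopa-Leindler inequality.\<close>

lemma nn_integral_less_truncate:
  fixes f :: "'a \<Rightarrow> ennreal"
  assumes [measurable]: "f \<in> borel_measurable M" and a: "a < (\<integral>\<^sup>+x. f x \<partial>M)"
  obtains n :: nat where "a < (\<integral>\<^sup>+x. min (f x) (of_nat n) \<partial>M)"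
proof -
  have "(SUP n::nat. min (f x) (of_nat n)) = f x" for x
  proof -
    have "(SUP n::nat. min (f x) (of_nat n)) = min (f x) (SUP n::nat. of_nat n)"
      by (simp add: inf_min[symmetric] inf_SUP)
    then show ?thesis by (simp add: ennreal_SUP_of_nat_eq_top)
  qed
  then have "(\<integral>\<^sup>+x. f x \<partial>M) = (\<integral>\<^sup>+x. (SUP n::nat. min (f x) (of_nat n)) \<partial>M)" by simp
  also have "\<dots> = (SUP n::nat. \<integral>\<^sup>+x. min (f x) (of_nat n) \<partial>M)"
    by (rule nn_integral_monotone_convergence_SUP) (auto simp: incseq_def le_fun_def min_le_iff_disj)
  finally show ?thesis using a that by (auto simp: less_SUP_iff)
qed

text \<open>After truncation, \<open>f\<close> and \<open>g\<close> are divided by their suprema, so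
  that the additive inequality for functions with supremum 1 applies. The weighted
  arithmetic-geometric mean inequality then turns the sum into a product.\<close>

lemma prekopa_leindler_real:
  fixes f g h :: "real \<Rightarrow> ennreal"
  assumes [measurable]: "f \<in> borel_measurable borel" "g \<in> borel_measurable borel" "h \<in> borel_measurable borel"
    and l: "0 < l" "l < 1"
    and h: "\<And>x y. geo_le l (f x) (g y) (h (l * x + (1 - l) * y))"
  shows "geo_le l (\<integral>\<^sup>+x. f x \<partial>lborel) (\<integral>\<^sup>+x. g x \<partial>lborel) (\<integral>\<^sup>+x. h x \<partial>lborel)"
  unfolding geo_le_def
proof (intro allI impI)
  fix a b :: real
  assume a: "0 < a" "ennreal a < (\<integral>\<^sup>+x. f x \<partial>lborel)" and b: "0 < b" "ennreal b < (\<integral>\<^sup>+x. g x \<partial>lborel)"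
  \<comment> \<open>Here \<open>m\<close> is the supremum of a truncation of \<open>f\<close> whose
    integral still exceeds \<open>a\<close>, and \<open>F\<close> is that truncation divided by
    \<open>m\<close>.\<close>
  have normalize: "\<exists>(F :: real \<Rightarrow> ennreal) m. F \<in> borel_measurable borel \<and> 0 < m \<and> (\<forall>x. F x \<le> 1) \<and>
      (\<forall>s. 0 < s \<longrightarrow> s < 1 \<longrightarrow> (\<exists>x. ennreal s < F x)) \<and> (\<forall>x. ennreal m * F x \<le> f x) \<and>
      ennreal a \<le> ennreal m * (\<integral>\<^sup>+x. F x \<partial>lborel)"
    if [measurable]: "f \<in> borel_measurable borel" and a: "0 < a" "ennreal a < (\<integral>\<^sup>+x. f x \<partial>lborel)"
    for f :: "real \<Rightarrow> ennreal" and a :: real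
  proof -
    obtain n :: nat where n: "ennreal a < (\<integral>\<^sup>+x. min (f x) (of_nat n) \<partial>lborel)"
      using nn_integral_less_truncate[of f lborel "ennreal a"] a by auto
    define S where "S = (SUP x. min (f x) (of_nat n))"
    have "S \<le> of_nat n" unfolding S_def by (intro SUP_least) simp
    then have "S < \<infinity>" by (simp add: le_less_trans of_nat_less_top)
    moreover have "S \<noteq> 0"
    proof
      assume "S = 0"
      then have "min (f x) (of_nat n) = 0" for x
        unfolding S_def by (metis SUP_upper UNIV_I le_zero_eq)
      then show False using n by simp
    qed
    ultimately obtain m where m: "S = ennreal m" "0 < m"
      by (cases S) (auto simp: less_le)
    define F where "F x = ennreal (1 / m) * min (f x) (of_nat n)" for x
    have mF: "ennreal m * F x = min (f x) (of_nat n)" for x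
      using m by (simp add: F_def mult.assoc[symmetric] ennreal_mult[symmetric])
    have up: "ennreal m * F x \<le> ennreal m" for x
      unfolding mF unfolding m(1)[symmetric] S_def by (rule SUP_upper) simp
    have cancel: "ennreal m * u \<le> ennreal m * v \<longleftrightarrow> u \<le> v" for u v
      using m by (subst ennreal_mult_le_mult_iff) auto
    show ?thesis
    proof (rule exI[of _ F], rule exI[of _ m], intro conjI allI impI)
      show "F \<in> borel_measurable borel" unfolding F_def by measurable
      show "0 < m" by fact
      show "F x \<le> 1" for x using up[of x] cancel[of "F x" 1] by simp
      show "ennreal m * F x \<le> f x" for x unfolding mF by simp
      show "ennreal a \<le> ennreal m * (\<integral>\<^sup>+x. F x \<partial>lborel)"
        using n by (simp add: F_def nn_integral_cmult[symmetric] mF[unfolded F_def])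
      fix s :: real assume s: "0 < s" "s < 1"
      then have "ennreal (m * s) < S" using m by (simp add: ennreal_less_iff)
      then obtain x where "ennreal (m * s) < min (f x) (of_nat n)"
        unfolding S_def less_SUP_iff by auto
      then have "\<not> ennreal m * F x \<le> ennreal m * ennreal s"
        using m s by (simp add: mF ennreal_mult[symmetric] not_le)
      then show "\<exists>x. ennreal s < F x" unfolding cancel not_le by blast
    qed
  qed
  obtain F m where F[measurable]: "F \<in> borel_measurable borel" and m: "0 < m" and F1: "\<And>x. F x \<le> 1"
    and Fs: "\<And>s. 0 < s \<Longrightarrow> s < 1 \<Longrightarrow> \<exists>x. ennreal s < F x" and Ff: "\<And>x. ennreal m * F x \<le> f x"
    and Fa: "ennreal a \<le> ennreal m * (\<integral>\<^sup>+x. F x \<partial>lborel)"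
    using normalize[of f a] a by auto
  obtain G n where G[measurable]: "G \<in> borel_measurable borel" and n: "0 < n" and G1: "\<And>x. G x \<le> 1"
    and Gs: "\<And>s. 0 < s \<Longrightarrow> s < 1 \<Longrightarrow> \<exists>x. ennreal s < G x" and Gg: "\<And>x. ennreal n * G x \<le> g x"
    and Gb: "ennreal b \<le> ennreal n * (\<integral>\<^sup>+x. G x \<partial>lborel)"
    using normalize[of g b] b by auto
  \<comment> \<open>Dividing \<open>f\<close> by \<open>m\<close> and \<open>g\<close> by
    \<open>n\<close> forces division of \<open>h\<close> by the geometric mean \<open>C\<close> of
    these constants.\<close>
  define C where "C = m powr l * n powr (1 - l)"
  have C: "0 < C" using m n by (simp add: C_def)
  have scale: "ennreal (c / d) \<le> u" if "ennreal c \<le> ennreal d * u" "0 < d" "0 < c" for c d u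
  proof -
    have "ennreal (1 / d) * ennreal c \<le> ennreal (1 / d) * (ennreal d * u)"
      using that by (intro mult_left_mono) auto
    then show ?thesis using that by (simp add: mult.assoc[symmetric] ennreal_mult[symmetric])
  qed
  have "ennreal s \<le> ennreal (1 / C) * h (l * x + (1 - l) * y)"
    if s: "0 < s" and Fx: "ennreal s < F x" and Gy: "ennreal s < G y" for s x y
  proof -
    have "ennreal (m * s) < ennreal m * F x" "ennreal (n * s) < ennreal n * G y"
      using m n s Fx Gy by (auto simp: ennreal_mult intro!: ennreal_mult_strict_left_mono)
    then have "ennreal ((m * s) powr l * (n * s) powr (1 - l)) \<le> h (l * x + (1 - l) * y)"
      using Ff[of x] Gg[of y] s m n by (intro geo_leD[OF h]) auto
    also have "(m * s) powr l * (n * s) powr (1 - l) = C * s"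
      using s m n by (simp add: C_def powr_mult powr_add[symmetric] mult_ac)
    finally have "ennreal (1 / C) * ennreal (C * s) \<le> ennreal (1 / C) * h (l * x + (1 - l) * y)"
      by (intro mult_left_mono) auto
    then show ?thesis using C s by (simp add: ennreal_mult[symmetric])
  qed
  then have "ennreal l * (\<integral>\<^sup>+x. F x \<partial>lborel) + ennreal (1 - l) * (\<integral>\<^sup>+x. G x \<partial>lborel)
      \<le> (\<integral>\<^sup>+x. ennreal (1 / C) * h x \<partial>lborel)"
    by (intro brunn_minkowski_real_nn_integral l F1 G1 Fs Gs) auto
  note F_G_h = this
  \<comment> \<open>The weighted arithmetic-geometric mean inequality, in the form of Young's
    inequality.\<close>
  have "ennreal ((a / m) powr l * (b / n) powr (1 - l)) \<le> ennreal (l * (a / m) + (1 - l) * (b / n))"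
    using a b m n l by (intro ennreal_leI Youngs_inequality_0) auto
  also have "\<dots> = ennreal l * ennreal (a / m) + ennreal (1 - l) * ennreal (b / n)"
    using a(1) b(1) m n l
    by (simp only: ennreal_plus ennreal_mult divide_nonneg_pos less_imp_le mult_nonneg_nonneg
        diff_ge_0_iff_ge)
  also have "\<dots> \<le> ennreal l * (\<integral>\<^sup>+x. F x \<partial>lborel) + ennreal (1 - l) * (\<integral>\<^sup>+x. G x \<partial>lborel)"
    using Fa Gb m n a(1) b(1) by (intro add_mono mult_left_mono scale) auto
  also have "\<dots> \<le> (\<integral>\<^sup>+x. ennreal (1 / C) * h x \<partial>lborel)" by (rule F_G_h)
  also have "\<dots> = ennreal (1 / C) * (\<integral>\<^sup>+x. h x \<partial>lborel)"
    by (simp add: nn_integral_cmult)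
  finally have le: "ennreal ((a / m) powr l * (b / n) powr (1 - l)) \<le> ennreal (1 / C) * (\<integral>\<^sup>+x. h x \<partial>lborel)" .
  have "a powr l * b powr (1 - l) = C * ((a / m) powr l * (b / n) powr (1 - l))"
    using a(1) b(1) m n by (simp add: C_def powr_divide)
  also have "ennreal \<dots> = ennreal C * ennreal ((a / m) powr l * (b / n) powr (1 - l))"
    using C by (intro ennreal_mult) auto
  also have "\<dots> \<le> ennreal C * (ennreal (1 / C) * (\<integral>\<^sup>+x. h x \<partial>lborel))"
    by (intro mult_left_mono le) auto
  also have "\<dots> = ennreal (C * (1 / C)) * (\<integral>\<^sup>+x. h x \<partial>lborel)"
    using C by (subst ennreal_mult) (auto simp: mult.assoc)
  also have "\<dots> = (\<integral>\<^sup>+x. h x \<partial>lborel)" using C by simp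
  finally show "ennreal (a powr l * b powr (1 - l)) \<le> (\<integral>\<^sup>+x. h x \<partial>lborel)" .
qed

section \<open>Prekopa-Leindler inequality and reflection in finite products\<close>

lemma prekopa_leindler_PiM:
  fixes f g h :: "('i \<Rightarrow> real) \<Rightarrow> ennreal"
  assumes "finite I"
    and "f \<in> borel_measurable (PiM I (\<lambda>_. lborel))" "g \<in> borel_measurable (PiM I (\<lambda>_. lborel))"
      "h \<in> borel_measurable (PiM I (\<lambda>_. lborel))"
    and l: "0 < l" "l < 1"
    and "\<And>x y. x \<in> space (PiM I (\<lambda>_. lborel)) \<Longrightarrow> y \<in> space (PiM I (\<lambda>_. lborel)) \<Longrightarrow>
      geo_le l (f x) (g y) (h (\<lambda>i. l * x i + (1 - l) * y i))"
  shows "geo_le l (\<integral>\<^sup>+x. f x \<partial>PiM I (\<lambda>_. lborel)) (\<integral>\<^sup>+x. g x \<partial>PiM I (\<lambda>_. lborel))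
    (\<integral>\<^sup>+x. h x \<partial>PiM I (\<lambda>_. lborel))"
  using assms(1-4,7)
proof (induction I arbitrary: f g h rule: finite_induct)
  case empty
  interpret product_sigma_finite "\<lambda>_::'i. lborel :: real measure" ..
  \<comment> \<open>The empty product is a single point, the constant function
    \<open>undefined\<close>; it is fixed by convex combinations because the weights add up to
    1.\<close>
  have "geo_le l (f (\<lambda>_. undefined)) (g (\<lambda>_. undefined)) (h (\<lambda>_. l * undefined + (1 - l) * undefined))"
    using empty(4)[of "\<lambda>_. undefined" "\<lambda>_. undefined"] by (simp add: space_PiM)
  moreover have "l * undefined + (1 - l) * undefined = (undefined :: real)"
    by (simp add: algebra_simps)
  ultimately show ?case by (simp add: PiM_empty nn_integral_count_space_finite)
next
  case (insert i I)
  interpret product_sigma_finite "\<lambda>_::'i. lborel :: real measure" ..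
  note [measurable] = insert.prems(1-3)
  let ?P = "PiM I (\<lambda>_. lborel :: real measure)"
  have upd: "(\<lambda>t. x(i := t)) \<in> borel \<rightarrow>\<^sub>M PiM (insert i I) (\<lambda>_. lborel)" if "x \<in> space ?P" for x
    using measurable_component_update[OF that, of i] insert.hyps by simp
  have meas: "(\<lambda>x. \<integral>\<^sup>+t. f (x(i := t)) \<partial>lborel) \<in> borel_measurable ?P"
    if [measurable]: "f \<in> borel_measurable (PiM (insert i I) (\<lambda>_. lborel))" for f :: "('i \<Rightarrow> real) \<Rightarrow> ennreal"
    by measurable
  \<comment> \<open>For fixed remaining coordinates, the one-dimensional inequality in coordinate
    \<open>i\<close> shows that the three partial integrals satisfy the hypothesis of the
    induction.\<close>
  have "geo_le l (\<integral>\<^sup>+x. (\<integral>\<^sup>+t. f (x(i := t)) \<partial>lborel) \<partial>?P) (\<integral>\<^sup>+x. (\<integral>\<^sup>+t. g (x(i := t)) \<partial>lborel) \<partial>?P)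
      (\<integral>\<^sup>+x. (\<integral>\<^sup>+t. h (x(i := t)) \<partial>lborel) \<partial>?P)"
  proof (intro insert.IH meas insert.prems(1-3))
    fix x y assume x: "x \<in> space ?P" and y: "y \<in> space ?P"
    define z where "z = (\<lambda>j. l * x j + (1 - l) * y j)"
    \<comment> \<open>outside \<open>I\<close>, this reads \<open>l * undefined + (1 - l) * undefined = undefined\<close>\<close>
    have z: "z \<in> space ?P"
      using x y by (auto simp: z_def space_PiM PiE_iff extensional_def algebra_simps)
    have xi: "x(i := s) \<in> space (PiM (insert i I) (\<lambda>_. lborel))" if "x \<in> space ?P" for x s
      using measurable_space[OF upd[OF that], of s] by simp
    show "geo_le l (\<integral>\<^sup>+t. f (x(i := t)) \<partial>lborel) (\<integral>\<^sup>+t. g (y(i := t)) \<partial>lborel)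
        (\<integral>\<^sup>+t. h ((\<lambda>j. l * x j + (1 - l) * y j)(i := t)) \<partial>lborel)"
      unfolding z_def[symmetric]
    proof (intro prekopa_leindler_real l)
      show "(\<lambda>t. f (x(i := t))) \<in> borel_measurable borel" using measurable_compose[OF upd[OF x] insert.prems(1)] .
      show "(\<lambda>t. g (y(i := t))) \<in> borel_measurable borel" using measurable_compose[OF upd[OF y] insert.prems(2)] .
      show "(\<lambda>t. h (z(i := t))) \<in> borel_measurable borel" using measurable_compose[OF upd[OF z] insert.prems(3)] .
      fix s t :: real
      have "(\<lambda>j. l * (x(i := s)) j + (1 - l) * (y(i := t)) j) = z(i := l * s + (1 - l) * t)"
        by (auto simp: z_def)
      then show "geo_le l (f (x(i := s))) (g (y(i := t))) (h (z(i := l * s + (1 - l) * t)))"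
        using insert.prems(4)[OF xi[OF x, of s] xi[OF y, of t]] by (simp only:)
    qed
  qed
  then show ?case
    by (simp only: product_nn_integral_insert[OF insert.hyps insert.prems(1)]
        product_nn_integral_insert[OF insert.hyps insert.prems(2)]
        product_nn_integral_insert[OF insert.hyps insert.prems(3)])
qed

text \<open>The coordinates are reflected one at a time. Restricting to \<open>I\<close> keeps the
  reflected point in the extensional function space. This serves the evenness of marginals.\<close>

lemma nn_integral_PiM_lborel_uminus:
  fixes f :: "('i \<Rightarrow> real) \<Rightarrow> ennreal"
  assumes "finite I" and "f \<in> borel_measurable (PiM I (\<lambda>_. lborel))"
  shows "(\<integral>\<^sup>+x. f (\<lambda>i\<in>I. - x i) \<partial>PiM I (\<lambda>_. lborel)) = (\<integral>\<^sup>+x. f x \<partial>PiM I (\<lambda>_. lborel))"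
  using assms
proof (induction I arbitrary: f rule: finite_induct)
  case empty
  interpret product_sigma_finite "\<lambda>_::'i. lborel :: real measure" ..
  show ?case by (simp add: PiM_empty nn_integral_count_space_finite restrict_def)
next
  case (insert i I)
  interpret product_sigma_finite "\<lambda>_::'i. lborel :: real measure" ..
  note [measurable] = insert.prems
  let ?P = "PiM I (\<lambda>_. lborel :: real measure)"
  have upd: "(\<lambda>t. x(i := t)) \<in> borel \<rightarrow>\<^sub>M PiM (insert i I) (\<lambda>_. lborel)" if "x \<in> space ?P" for x
    using measurable_component_update[OF that, of i] insert.hyps by simp
  have "(\<integral>\<^sup>+x. f (\<lambda>j\<in>insert i I. - x j) \<partial>PiM (insert i I) (\<lambda>_. lborel))
      = (\<integral>\<^sup>+x. (\<integral>\<^sup>+t. f (\<lambda>j\<in>insert i I. - (x(i := t)) j) \<partial>lborel) \<partial>?P)"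
    using insert.hyps by (intro product_nn_integral_insert) measurable
  also have "\<dots> = (\<integral>\<^sup>+x. (\<integral>\<^sup>+t. f ((\<lambda>j\<in>I. - x j)(i := t)) \<partial>lborel) \<partial>?P)"
  proof (rule nn_integral_cong)
    fix x assume x: "x \<in> space ?P"
    have "(\<lambda>j\<in>I. - x j) \<in> space ?P" by (auto simp: space_PiM)
    then have m: "(\<lambda>t. f ((\<lambda>j\<in>I. - x j)(i := t))) \<in> borel_measurable borel"
      using measurable_compose[OF upd insert.prems] by blast
    have "(\<lambda>j\<in>insert i I. - (x(i := t)) j) = (\<lambda>j\<in>I. - x j)(i := 0 + (-1) * t)" for t
      using insert.hyps by (auto simp: fun_eq_iff restrict_def)
    then show "(\<integral>\<^sup>+t. f (\<lambda>j\<in>insert i I. - (x(i := t)) j) \<partial>lborel) = (\<integral>\<^sup>+t. f ((\<lambda>j\<in>I. - x j)(i := t)) \<partial>lborel)"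
      using nn_integral_real_affine[OF m, of "-1" 0] by simp
  qed
  also have "\<dots> = (\<integral>\<^sup>+x. (\<integral>\<^sup>+t. f (x(i := t)) \<partial>lborel) \<partial>?P)"
    by (rule insert.IH[where f = "\<lambda>x. \<integral>\<^sup>+t. f (x(i := t)) \<partial>lborel"]) measurable
  also have "\<dots> = (\<integral>\<^sup>+x. f x \<partial>PiM (insert i I) (\<lambda>_. lborel))"
    by (rule product_nn_integral_insert[OF insert.hyps insert.prems, symmetric])
  finally show ?case .
qed

lemma geo_le_ennreal:
  assumes "u powr l * v powr (1 - l) \<le> w" "0 < l" "l < 1"
  shows "geo_le l (ennreal u) (ennreal v) (ennreal w)"
  unfolding geo_le_def
proof (intro allI impI ennreal_leI)
  fix a b :: real assume ab: "0 < a" "0 < b" "ennreal a < ennreal u" "ennreal b < ennreal v"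
  then have "a powr l * b powr (1 - l) \<le> u powr l * v powr (1 - l)"
    using assms(2,3) by (intro mult_mono powr_mono2) (auto simp: ennreal_less_iff)
  then show "a powr l * b powr (1 - l) \<le> w" using assms(1) by simp
qed

section \<open>Even log-concave functions and their marginals\<close>

text \<open>The multiplicative form of log-concavity admits zeros: since
  \<open>0 powr l = 0\<close>, the inequality is trivial as soon as one of the two values vanishes.
  This matters for Gaussians cut off to an interval.\<close>

definition even_log_concave :: "('a::euclidean_space \<Rightarrow> real) \<Rightarrow> bool" where
  "even_log_concave F \<longleftrightarrow> F \<in> borel_measurable borel \<and> (\<forall>x. 0 \<le> F x) \<and> (\<forall>x. F (- x) = F x) \<and>
     (\<forall>x y l. 0 < l \<longrightarrow> l < 1 \<longrightarrow> F x powr l * F y powr (1 - l) \<le> F (l *\<^sub>R x + (1 - l) *\<^sub>R y))"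

lemma even_log_concaveD:
  assumes "even_log_concave F"
  shows "F \<in> borel_measurable borel" "0 \<le> F x" "F (- x) = F x"
    "0 < l \<Longrightarrow> l < 1 \<Longrightarrow> F x powr l * F y powr (1 - l) \<le> F (l *\<^sub>R x + (1 - l) *\<^sub>R y)"
  using assms by (auto simp: even_log_concave_def)

lemma even_log_concave_1: "even_log_concave (\<lambda>_. 1)"
  by (simp add: even_log_concave_def)

lemma even_log_concave_mult:
  assumes F: "even_log_concave F" and G: "even_log_concave G"
  shows "even_log_concave (\<lambda>x. F x * G x)"
  unfolding even_log_concave_def
proof (intro conjI allI impI)
  note D = even_log_concaveD[OF F] even_log_concaveD[OF G]
  show "(\<lambda>x. F x * G x) \<in> borel_measurable borel" using D(1,5) by measurable
  show "0 \<le> F x * G x" "F (- x) * G (- x) = F x * G x" for x by (simp_all add: D)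
  fix x y l assume l: "0 < (l::real)" "l < 1"
  have "(F x * G x) powr l * (F y * G y) powr (1 - l)
      = (F x powr l * F y powr (1 - l)) * (G x powr l * G y powr (1 - l))"
    by (simp add: powr_mult D mult_ac)
  also have "\<dots> \<le> F (l *\<^sub>R x + (1 - l) *\<^sub>R y) * G (l *\<^sub>R x + (1 - l) *\<^sub>R y)"
    using D l by (intro mult_mono) auto
  finally show "(F x * G x) powr l * (F y * G y) powr (1 - l)
      \<le> F (l *\<^sub>R x + (1 - l) *\<^sub>R y) * G (l *\<^sub>R x + (1 - l) *\<^sub>R y)" .
qed

lemma even_log_concave_prod:
  "(\<And>i. i \<in> J \<Longrightarrow> even_log_concave (F i)) \<Longrightarrow> even_log_concave (\<lambda>x. \<Prod>i\<in>J. F i x)"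
  by (induction J rule: infinite_finite_induct) (auto intro: even_log_concave_1 even_log_concave_mult)

lemma borel_measurable_linear:
  fixes T :: "'a::euclidean_space \<Rightarrow> 'b::euclidean_space"
  shows "linear T \<Longrightarrow> T \<in> borel_measurable borel"
  by (intro borel_measurable_continuous_onI linear_continuous_on linear_conv_bounded_linear[THEN iffD1])

lemma even_log_concave_linear:
  assumes F: "even_log_concave F" and T: "linear T"
  shows "even_log_concave (\<lambda>x. F (T x))"
  unfolding even_log_concave_def
proof (intro conjI allI impI)
  note D = even_log_concaveD[OF F]
  show "(\<lambda>x. F (T x)) \<in> borel_measurable borel"
    using borel_measurable_linear[OF T] D(1) by (rule measurable_compose)
  show "0 \<le> F (T x)" "F (T (- x)) = F (T x)" for x by (simp_all add: D linear_neg[OF T])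
  show "F (T x) powr l * F (T y) powr (1 - l) \<le> F (T (l *\<^sub>R x + (1 - l) *\<^sub>R y))"
    if "0 < l" "l < 1" for x y l
    using D(4)[OF that] by (simp add: linear_add[OF T] linear_cmul[OF T])
qed

text \<open>For \<open>u\<close> in \<open>Basis\<close>, parametrizes the hyperplane
  \<open>u \<bullet> x = t\<close> by the coordinates along the other basis vectors, so that
  integration over it is integration over a product space.\<close>

definition hyperplane_point :: "'a::euclidean_space \<Rightarrow> real \<Rightarrow> ('a \<Rightarrow> real) \<Rightarrow> 'a" where
  "hyperplane_point u t c = t *\<^sub>R u + (\<Sum>b\<in>Basis - {u}. c b *\<^sub>R b)"

text \<open>Extended values, since the integral of a log-concave function over a hyperplane may be
  infinite.\<close>

definition marginal :: "'a::euclidean_space \<Rightarrow> ('a \<Rightarrow> ennreal) \<Rightarrow> real \<Rightarrow> ennreal" where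
  "marginal u F t = (\<integral>\<^sup>+c. F (hyperplane_point u t c) \<partial>PiM (Basis - {u}) (\<lambda>_. lborel))"

lemma hyperplane_point_measurable:
  "(\<lambda>(t, c). hyperplane_point u t c) \<in> borel \<Otimes>\<^sub>M PiM (Basis - {u}) (\<lambda>_. lborel) \<rightarrow>\<^sub>M borel"
  unfolding hyperplane_point_def by measurable

lemma hyperplane_point_measurable2:
  "hyperplane_point u t \<in> PiM (Basis - {u}) (\<lambda>_. lborel) \<rightarrow>\<^sub>M borel"
  unfolding hyperplane_point_def by measurable

lemma inner_hyperplane_point:
  assumes "u \<in> Basis" shows "u \<bullet> hyperplane_point u t c = t"
proof -
  have "(\<Sum>b\<in>Basis - {u}. c b * (u \<bullet> b)) = 0"
    using assms by (intro sum.neutral) (auto simp: inner_Basis)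
  then show ?thesis
    using assms by (simp add: hyperplane_point_def inner_add_right inner_sum_right)
qed

lemma hyperplane_point_combination:
  "hyperplane_point u (l * s + m * t) (\<lambda>b. l * x b + m * y b)
    = l *\<^sub>R hyperplane_point u s x + m *\<^sub>R hyperplane_point u t y"
  by (simp add: hyperplane_point_def scaleR_add_left scaleR_add_right sum.distrib scaleR_sum_right)

lemma marginal_measurable:
  assumes "F \<in> borel_measurable borel"
  shows "marginal u F \<in> borel_measurable borel"
proof -
  interpret P: product_sigma_finite "\<lambda>_. lborel :: real measure" ..
  interpret sigma_finite_measure "PiM (Basis - {u}) (\<lambda>_. lborel :: real measure)"
    by (rule P.sigma_finite) simp
  have "(\<lambda>(t, c). F (hyperplane_point u t c)) \<in> borel_measurable (borel \<Otimes>\<^sub>M PiM (Basis - {u}) (\<lambda>_. lborel))"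
    using measurable_compose[OF hyperplane_point_measurable assms] by (simp add: case_prod_unfold)
  then show ?thesis unfolding marginal_def by (rule borel_measurable_nn_integral)
qed

text \<open>Tonelli: Lebesgue measure is the image of the product measure over \<open>Basis\<close>,
  from which the coordinate \<open>u\<close> is split off.\<close>

lemma nn_integral_lborel_marginal:
  assumes F: "F \<in> borel_measurable borel" and u: "u \<in> Basis"
  shows "(\<integral>\<^sup>+x. F x \<partial>lborel) = (\<integral>\<^sup>+t. marginal u F t \<partial>lborel)"
proof -
  interpret P: product_sigma_finite "\<lambda>_. lborel :: real measure" ..
  have ins: "insert u (Basis - {u}) = Basis" using u by auto
  define e where "e c = (\<Sum>b\<in>Basis. c b *\<^sub>R b)" for c :: "'a \<Rightarrow> real"
  have e: "e \<in> PiM Basis (\<lambda>_. lborel) \<rightarrow>\<^sub>M borel" unfolding e_def by measurable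
  have upd: "e (c(u := t)) = hyperplane_point u t c" for c t
  proof -
    have "(\<Sum>b\<in>Basis. (c(u := t)) b *\<^sub>R b) = (c(u := t)) u *\<^sub>R u + (\<Sum>b\<in>Basis - {u}. (c(u := t)) b *\<^sub>R b)"
      using u by (intro sum.remove) auto
    also have "(\<Sum>b\<in>Basis - {u}. (c(u := t)) b *\<^sub>R b) = (\<Sum>b\<in>Basis - {u}. c b *\<^sub>R b)"
      by (intro sum.cong) auto
    finally show ?thesis by (simp add: e_def hyperplane_point_def)
  qed
  have "(\<integral>\<^sup>+x. F x \<partial>lborel) = (\<integral>\<^sup>+c. F (e c) \<partial>PiM Basis (\<lambda>_. lborel))"
    using F e by (subst lborel_eq) (simp add: e_def nn_integral_distr)
  also have "\<dots> = (\<integral>\<^sup>+t. (\<integral>\<^sup>+c. F (e (c(u := t))) \<partial>PiM (Basis - {u}) (\<lambda>_. lborel)) \<partial>lborel)"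
    using P.product_nn_integral_insert_rev[of "Basis - {u}" u "\<lambda>c. F (e c)"] measurable_compose[OF e F]
    unfolding ins by simp
  finally show ?thesis by (simp add: upd marginal_def)
qed

text \<open>Reflection at the origin exchanges the hyperplanes at heights \<open>t\<close> and
  \<open>- t\<close>, preserves \<open>F\<close>, and reflects the remaining coordinates, which
  leaves their integral unchanged.\<close>

lemma marginal_even:
  assumes F: "even_log_concave F"
  shows "marginal u (\<lambda>x. ennreal (F x)) (- t) = marginal u (\<lambda>x. ennreal (F x)) t"
proof -
  note D = even_log_concaveD[OF F]
  have F': "(\<lambda>x. ennreal (F x)) \<in> borel_measurable borel" using D(1) by simp
  have "F (hyperplane_point u (- t) c) = F (hyperplane_point u t (\<lambda>b\<in>Basis - {u}. - c b))" for c
  proof -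
    have "hyperplane_point u (- t) c = - hyperplane_point u t (\<lambda>b\<in>Basis - {u}. - c b)"
      by (simp add: hyperplane_point_def sum_negf)
    then show ?thesis by (simp add: D)
  qed
  then show ?thesis
    unfolding marginal_def
    using nn_integral_PiM_lborel_uminus[of "Basis - {u}" "\<lambda>c. ennreal (F (hyperplane_point u t c))"]
      measurable_compose[OF hyperplane_point_measurable2 F'] by simp
qed

text \<open>The height \<open>s\<close> is a convex combination of \<open>t\<close> and
  \<open>- t\<close>. By the Prekopa-Leindler inequality the marginal at \<open>s\<close> is at
  least the geometric mean of those at \<open>t\<close> and \<open>- t\<close>, and these two
  coincide.\<close>

lemma marginal_antimono:
  assumes F: "even_log_concave F" and st: "\<bar>s\<bar> \<le> \<bar>t\<bar>"
  shows "marginal u (\<lambda>x. ennreal (F x)) t \<le> marginal u (\<lambda>x. ennreal (F x)) s"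
proof (cases "\<bar>s\<bar> = \<bar>t\<bar>")
  case True
  then have "s = t \<or> s = - t" by linarith
  then show ?thesis using marginal_even[OF F] by auto
next
  case False
  note D = even_log_concaveD[OF F]
  have F': "(\<lambda>x. ennreal (F x)) \<in> borel_measurable borel" using D(1) by simp
  let ?m = "marginal u (\<lambda>x. ennreal (F x))"
  have t: "\<bar>s\<bar> < \<bar>t\<bar>" using False st by simp
  \<comment> \<open>The solution of \<open>l * t + (1 - l) * (- t) = s\<close>; it lies strictly
    between 0 and 1 because \<open>\<bar>s\<bar> < \<bar>t\<bar>\<close>.\<close>
  define l where "l = (s / t + 1) / 2"
  have "\<bar>s / t\<bar> < 1" unfolding abs_divide using t by (subst divide_less_eq_1) auto
  then have "-1 < s / t \<and> s / t < 1" by linarith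
  then have l: "0 < l" "l < 1" by (simp_all add: l_def)
  have s: "l * t + (1 - l) * (- t) = s"
    using t by (auto simp: l_def field_simps)
  have "geo_le l (?m t) (?m (- t)) (?m s)"
    unfolding marginal_def
  proof (intro prekopa_leindler_PiM l measurable_compose[OF hyperplane_point_measurable2 F'])
    fix x y :: "'a \<Rightarrow> real"
    have "hyperplane_point u s (\<lambda>b. l * x b + (1 - l) * y b)
        = l *\<^sub>R hyperplane_point u t x + (1 - l) *\<^sub>R hyperplane_point u (- t) y"
      using hyperplane_point_combination[of u l t "1 - l" "- t" x y] by (simp only: s)
    then show "geo_le l (ennreal (F (hyperplane_point u t x))) (ennreal (F (hyperplane_point u (- t) y)))
        (ennreal (F (hyperplane_point u s (\<lambda>b. l * x b + (1 - l) * y b))))"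
      using D(4)[OF l] l by (intro geo_le_ennreal) auto
  qed simp
  then show ?thesis by (auto simp: marginal_even[OF F] intro: geo_le_same)
qed

section \<open>Peakedness\<close>

text \<open>A one-crossing form of the peakedness order: the condition on the integrals says that
  the mass of \<open>q\<close> beyond \<open>c\<close> is at most the excess of \<open>p\<close>
  over \<open>q\<close> within \<open>c\<close>. Finite mass of \<open>q\<close> allows the common
  part to be cancelled.\<close>

definition more_peaked :: "(real \<Rightarrow> ennreal) \<Rightarrow> (real \<Rightarrow> ennreal) \<Rightarrow> bool" where
  "more_peaked p q \<longleftrightarrow> p \<in> borel_measurable borel \<and> q \<in> borel_measurable borel \<and>
     (\<integral>\<^sup>+t. q t \<partial>lborel) \<le> (\<integral>\<^sup>+t. p t \<partial>lborel) \<and> (\<integral>\<^sup>+t. q t \<partial>lborel) < \<infinity> \<and>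
     (\<exists>c\<ge>0. (\<forall>t. \<bar>t\<bar> \<le> c \<longrightarrow> q t \<le> p t) \<and> (\<forall>t. c < \<bar>t\<bar> \<longrightarrow> p t = 0))"

lemma more_peaked_scale:
  assumes pq: "more_peaked p q" and a: "0 < a"
  shows "more_peaked (\<lambda>t. p (a * t)) (\<lambda>t. q (a * t))"
proof -
  have [measurable]: "p \<in> borel_measurable borel" "q \<in> borel_measurable borel"
    using pq by (auto simp: more_peaked_def)
  have P: "(\<integral>\<^sup>+t. p t \<partial>lborel) = ennreal a * (\<integral>\<^sup>+t. p (a * t) \<partial>lborel)"
    using nn_integral_real_affine[of p a 0] a by simp
  have Q: "(\<integral>\<^sup>+t. q t \<partial>lborel) = ennreal a * (\<integral>\<^sup>+t. q (a * t) \<partial>lborel)"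
    using nn_integral_real_affine[of q a 0] a by simp
  have "(\<integral>\<^sup>+t. q t \<partial>lborel) \<le> (\<integral>\<^sup>+t. p t \<partial>lborel)" "(\<integral>\<^sup>+t. q t \<partial>lborel) < \<infinity>"
    using pq by (auto simp: more_peaked_def)
  then have "(\<integral>\<^sup>+t. q (a * t) \<partial>lborel) \<le> (\<integral>\<^sup>+t. p (a * t) \<partial>lborel)"
      "(\<integral>\<^sup>+t. q (a * t) \<partial>lborel) < \<infinity>"
    unfolding P Q using a
    by (auto simp: ennreal_mult_le_mult_iff ennreal_mult_less_top)
  moreover obtain c where c: "0 \<le> c" "\<And>t. \<bar>t\<bar> \<le> c \<Longrightarrow> q t \<le> p t" "\<And>t. c < \<bar>t\<bar> \<Longrightarrow> p t = 0"
    using pq by (auto simp: more_peaked_def)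
  moreover have "\<exists>c\<ge>0. (\<forall>t. \<bar>t\<bar> \<le> c \<longrightarrow> q (a * t) \<le> p (a * t)) \<and> (\<forall>t. c < \<bar>t\<bar> \<longrightarrow> p (a * t) = 0)"
    using a c by (intro exI[of _ "c / a"]) (auto simp: abs_mult field_simps)
  ultimately show ?thesis by (simp add: more_peaked_def)
qed

text \<open>Passing from \<open>q\<close> to \<open>p\<close> removes mass outside
  \<open>[-c, c]\<close>, where \<open>H\<close> is at most \<open>H c\<close>, and adds at least as
  much inside, where \<open>H\<close> is at least \<open>H c\<close>.\<close>

lemma nn_integral_more_peaked:
  assumes pq: "more_peaked p q" and H[measurable]: "H \<in> borel_measurable borel"
    and dec: "\<And>s t. \<bar>s\<bar> \<le> \<bar>t\<bar> \<Longrightarrow> H t \<le> H s"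
  shows "(\<integral>\<^sup>+t. H t * q t \<partial>lborel) \<le> (\<integral>\<^sup>+t. H t * p t \<partial>lborel)"
proof -
  have [measurable]: "p \<in> borel_measurable borel" "q \<in> borel_measurable borel"
    and le: "(\<integral>\<^sup>+t. q t \<partial>lborel) \<le> (\<integral>\<^sup>+t. p t \<partial>lborel)" and fin: "(\<integral>\<^sup>+t. q t \<partial>lborel) < \<infinity>"
    using pq by (auto simp: more_peaked_def)
  obtain c where c: "0 \<le> c" "\<And>t. \<bar>t\<bar> \<le> c \<Longrightarrow> q t \<le> p t" "\<And>t. c < \<bar>t\<bar> \<Longrightarrow> p t = 0"
    using pq by (auto simp: more_peaked_def)
  define I where "I = (indicator {-c..c} :: real \<Rightarrow> ennreal)"
  define J where "J = (indicator (- {-c..c}) :: real \<Rightarrow> ennreal)"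
  \<comment> \<open>The excess of \<open>p\<close> over \<open>q\<close> on the interval; the
    subtraction does not truncate there, as \<open>q \<le> p\<close>.\<close>
  define d where "d t = I t * (p t - q t)" for t
  have [measurable]: "I \<in> borel_measurable borel" "J \<in> borel_measurable borel" "d \<in> borel_measurable borel"
    unfolding d_def I_def J_def by measurable
  have p_eq: "p t = I t * q t + d t" for t
  proof (cases "\<bar>t\<bar> \<le> c")
    case True
    then have "t \<in> {-c..c}" by auto
    then show ?thesis using c(2)[OF True] by (simp add: d_def I_def add_diff_inverse_ennreal)
  next
    case False
    then have "t \<notin> {-c..c}" by auto
    then show ?thesis using c(3)[of t] False by (simp add: d_def I_def)
  qed
  have q_eq: "q t = I t * q t + J t * q t" for t
    by (auto simp: I_def J_def indicator_def)
  let ?q = "\<integral>\<^sup>+t. I t * q t \<partial>lborel"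
  have "?q \<le> (\<integral>\<^sup>+t. q t \<partial>lborel)"
    by (rule nn_integral_mono) (auto simp: I_def indicator_def)
  then have qfin: "?q \<noteq> \<infinity>" using fin by auto
  have "?q + (\<integral>\<^sup>+t. J t * q t \<partial>lborel) = (\<integral>\<^sup>+t. q t \<partial>lborel)"
    by (subst (3) q_eq) (simp add: nn_integral_add)
  also have "\<dots> \<le> (\<integral>\<^sup>+t. p t \<partial>lborel)" by (rule le)
  also have "\<dots> = ?q + (\<integral>\<^sup>+t. d t \<partial>lborel)"
    by (subst p_eq) (simp add: nn_integral_add)
  finally have Jd: "(\<integral>\<^sup>+t. J t * q t \<partial>lborel) \<le> (\<integral>\<^sup>+t. d t \<partial>lborel)"
    using qfin by (simp add: ennreal_add_left_cancel_le)
  \<comment> \<open>The value \<open>H c\<close> separates the values of \<open>H\<close> outside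
    the interval from those inside, so that the comparison of masses \<open>Jd\<close>
    suffices.\<close>
  have "(\<integral>\<^sup>+t. H t * (J t * q t) \<partial>lborel) \<le> (\<integral>\<^sup>+t. H c * (J t * q t) \<partial>lborel)"
    using c(1) by (intro nn_integral_mono) (auto simp: J_def indicator_def intro!: mult_right_mono dec)
  also have "\<dots> = H c * (\<integral>\<^sup>+t. J t * q t \<partial>lborel)" by (simp add: nn_integral_cmult)
  also have "\<dots> \<le> H c * (\<integral>\<^sup>+t. d t \<partial>lborel)" by (intro mult_left_mono Jd) simp
  also have "\<dots> = (\<integral>\<^sup>+t. H c * d t \<partial>lborel)" by (simp add: nn_integral_cmult)
  also have "\<dots> \<le> (\<integral>\<^sup>+t. H t * d t \<partial>lborel)"
    using c(1) by (intro nn_integral_mono) (auto simp: d_def I_def indicator_def intro!: mult_right_mono dec)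
  finally have main: "(\<integral>\<^sup>+t. H t * (J t * q t) \<partial>lborel) \<le> (\<integral>\<^sup>+t. H t * d t \<partial>lborel)" .
  have "(\<integral>\<^sup>+t. H t * q t \<partial>lborel) = (\<integral>\<^sup>+t. H t * (I t * q t) \<partial>lborel) + (\<integral>\<^sup>+t. H t * (J t * q t) \<partial>lborel)"
    by (subst q_eq) (simp add: nn_integral_add distrib_left)
  also have "\<dots> \<le> (\<integral>\<^sup>+t. H t * (I t * q t) \<partial>lborel) + (\<integral>\<^sup>+t. H t * d t \<partial>lborel)"
    by (intro add_left_mono main)
  also have "\<dots> = (\<integral>\<^sup>+t. H t * p t \<partial>lborel)"
    by (subst p_eq) (simp add: nn_integral_add distrib_left)
  finally show ?thesis .
qed

section \<open>Exchanging factors under an integral over \<open>real ^ 'k\<close>\<close>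

lemma nn_integral_lborel_isometry:
  fixes T :: "'a::euclidean_space \<Rightarrow> 'a"
  assumes "linear T" "\<And>x. norm (T x) = norm x" and f: "f \<in> borel_measurable borel"
  shows "(\<integral>\<^sup>+x. f (T x) \<partial>lborel) = (\<integral>\<^sup>+x. f x \<partial>lborel)"
  using borel_measurable_linear[OF assms(1)] f
  by (subst (2) distr_lborel_isometry[OF assms(1,2), symmetric]) (simp add: nn_integral_distr)

text \<open>A rotation takes the direction of \<open>a\<close> to a coordinate direction
  \<open>u\<close>. Integrating first over the hyperplanes orthogonal to \<open>u\<close> leaves a
  one-dimensional integral against an even marginal that decreases away from 0, to which peakedness
  applies.\<close>

lemma nn_integral_more_peaked_inner:
  fixes a :: "real ^ 'k"
  assumes pq: "more_peaked p q" and F: "even_log_concave F"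
  shows "(\<integral>\<^sup>+x. ennreal (F x) * q (a \<bullet> x) \<partial>lborel) \<le> (\<integral>\<^sup>+x. ennreal (F x) * p (a \<bullet> x) \<partial>lborel)"
proof (cases "a = 0")
  case True
  have "q 0 \<le> p 0" using pq by (auto simp: more_peaked_def)
  then show ?thesis using True by (intro nn_integral_mono mult_left_mono) auto
next
  case False
  obtain u :: "real ^ 'k" where u: "u \<in> Basis" using SOME_Basis by metis
  obtain T where T: "orthogonal_transformation T" "T (norm a *\<^sub>R u) = a"
    using orthogonal_transformation_exists[of "norm a *\<^sub>R u" a] u by auto
  have lin: "linear T" and iso: "norm (T x) = norm x" for x
    using T(1) by (auto simp: orthogonal_transformation)
  have inner: "a \<bullet> T x = norm a * (u \<bullet> x)" for x
  proof -
    have "T (norm a *\<^sub>R u) \<bullet> T x = (norm a *\<^sub>R u) \<bullet> x"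
      using T(1) unfolding orthogonal_transformation_def by blast
    then show ?thesis unfolding T(2) by simp
  qed
  note FT = even_log_concave_linear[OF F lin]
  have G[measurable]: "F \<in> borel_measurable borel" "(\<lambda>x. F (T x)) \<in> borel_measurable borel"
    using even_log_concaveD(1)[OF F] even_log_concaveD(1)[OF FT] by auto
  let ?H = "marginal u (\<lambda>x. ennreal (F (T x)))"
  \<comment> \<open>On each hyperplane the factor depending on \<open>a \<bullet> x\<close> is
    constant and can be pulled out of the marginal; only the scale \<open>norm a\<close> of its
    argument remains.\<close>
  have eq: "(\<integral>\<^sup>+x. ennreal (F x) * r (a \<bullet> x) \<partial>lborel) = (\<integral>\<^sup>+t. ?H t * r (norm a * t) \<partial>lborel)"
    if [measurable]: "r \<in> borel_measurable borel" for r
  proof -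
    have m: "(\<lambda>c. ennreal (F (T (hyperplane_point u t c)))) \<in> borel_measurable (PiM (Basis - {u}) (\<lambda>_. lborel))" for t
      using measurable_compose[OF hyperplane_point_measurable2 G(2)] by simp
    have "(\<integral>\<^sup>+x. ennreal (F x) * r (a \<bullet> x) \<partial>lborel) = (\<integral>\<^sup>+x. ennreal (F (T x)) * r (norm a * (u \<bullet> x)) \<partial>lborel)"
      by (subst nn_integral_lborel_isometry[OF lin iso, symmetric]) (simp_all add: inner)
    also have "\<dots> = (\<integral>\<^sup>+t. marginal u (\<lambda>x. ennreal (F (T x)) * r (norm a * (u \<bullet> x))) t \<partial>lborel)"
      by (rule nn_integral_lborel_marginal[OF _ u]) measurable
    also have "\<dots> = (\<integral>\<^sup>+t. ?H t * r (norm a * t) \<partial>lborel)"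
      using m by (simp add: marginal_def inner_hyperplane_point[OF u] nn_integral_multc)
    finally show ?thesis .
  qed
  have "(\<integral>\<^sup>+t. ?H t * q (norm a * t) \<partial>lborel) \<le> (\<integral>\<^sup>+t. ?H t * p (norm a * t) \<partial>lborel)"
    using False
    by (intro nn_integral_more_peaked more_peaked_scale pq marginal_antimono FT marginal_measurable) auto
  then show ?thesis using pq by (simp add: eq more_peaked_def)
qed

text \<open>The general factor \<open>F\<close> absorbs whatever is not being exchanged: first the
  single factor \<open>q (a j \<bullet> x)\<close> while the others are replaced by induction, then
  the replaced factors while the one for \<open>j\<close> follows.\<close>

lemma nn_integral_more_peaked_prod:
  fixes a :: "'i \<Rightarrow> real ^ 'k"
  assumes "finite J" and pq: "more_peaked (\<lambda>t. ennreal (p t)) (\<lambda>t. ennreal (q t))"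
    and p: "even_log_concave p" and q: "even_log_concave q" and "even_log_concave F"
  shows "(\<integral>\<^sup>+x. ennreal (F x * (\<Prod>j\<in>J. q (a j \<bullet> x))) \<partial>lborel)
    \<le> (\<integral>\<^sup>+x. ennreal (F x * (\<Prod>j\<in>J. p (a j \<bullet> x))) \<partial>lborel)"
  using assms(1,5)
proof (induction J arbitrary: F rule: finite_induct)
  case (insert j J)
  have lin: "linear (\<lambda>x. a i \<bullet> x)" for i
    by (simp add: bounded_linear.linear bounded_linear_inner_right)
  note nonneg = even_log_concaveD(2)
  let ?P = "\<lambda>x. \<Prod>i\<in>J. p (a i \<bullet> x)"
  have P: "even_log_concave (\<lambda>x. F x * ?P x)"
    by (intro even_log_concave_mult even_log_concave_prod even_log_concave_linear[OF p] lin insert.prems)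
  have "(\<integral>\<^sup>+x. ennreal (F x * (\<Prod>i\<in>insert j J. q (a i \<bullet> x))) \<partial>lborel)
      = (\<integral>\<^sup>+x. ennreal ((F x * q (a j \<bullet> x)) * (\<Prod>i\<in>J. q (a i \<bullet> x))) \<partial>lborel)"
    using insert.hyps by (simp add: mult_ac)
  also have "\<dots> \<le> (\<integral>\<^sup>+x. ennreal ((F x * q (a j \<bullet> x)) * ?P x) \<partial>lborel)"
    by (intro insert.IH even_log_concave_mult even_log_concave_linear[OF q] lin insert.prems)
  also have "\<dots> = (\<integral>\<^sup>+x. ennreal (F x * ?P x) * ennreal (q (a j \<bullet> x)) \<partial>lborel)"
    using nonneg[OF P] nonneg[OF q] by (simp add: ennreal_mult[symmetric] mult_ac)
  also have "\<dots> \<le> (\<integral>\<^sup>+x. ennreal (F x * ?P x) * ennreal (p (a j \<bullet> x)) \<partial>lborel)"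
    by (rule nn_integral_more_peaked_inner[OF pq P])
  also have "\<dots> = (\<integral>\<^sup>+x. ennreal (F x * (\<Prod>i\<in>insert j J. p (a i \<bullet> x))) \<partial>lborel)"
    using insert.hyps nonneg[OF P] nonneg[OF p] by (simp add: ennreal_mult[symmetric] mult_ac)
  finally show ?case .
qed simp

section \<open>Gaussian measures of slabs\<close>

definition trunc_gauss :: "real \<Rightarrow> real \<Rightarrow> real" where
  "trunc_gauss r t = exp (- t\<^sup>2 / 2) * indicator {-r..r} t"

text \<open>This is \<open>sqrt (2 * pi)\<close> times the Gaussian measure of
  \<open>[-r, r]\<close>. The integral is finite, so \<open>enn2real\<close> loses nothing.\<close>

definition trunc_mass :: "real \<Rightarrow> real" where
  "trunc_mass r = enn2real (\<integral>\<^sup>+t. ennreal (trunc_gauss r t) \<partial>lborel)"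

text \<open>Rescaled so that both the integral and the value at \<open>0\<close> are \<open>1\<close>; this is what makes the family
  comparable in the peakedness order.\<close>

definition norm_gauss :: "real \<Rightarrow> real \<Rightarrow> real" where
  "norm_gauss r t = trunc_gauss r (trunc_mass r * t)"

lemma trunc_gauss_measurable[measurable]: "trunc_gauss r \<in> borel_measurable borel"
  unfolding trunc_gauss_def by measurable

text \<open>The interval is convex and the square in the exponent is a convex function; if one of
  the points lies outside the interval, the left side is 0.\<close>

lemma even_log_concave_trunc_gauss: "even_log_concave (trunc_gauss r)"
  unfolding even_log_concave_def
proof (intro conjI allI impI)
  show "0 \<le> trunc_gauss r x" "trunc_gauss r (- x) = trunc_gauss r x" for x
    by (auto simp: trunc_gauss_def indicator_def)
  fix x y l :: real assume l: "0 < l" "l < 1"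
  show "trunc_gauss r x powr l * trunc_gauss r y powr (1 - l) \<le> trunc_gauss r (l *\<^sub>R x + (1 - l) *\<^sub>R y)"
  proof (cases "x \<in> {-r..r} \<and> y \<in> {-r..r}")
    case True
    then have "l *\<^sub>R x + (1 - l) *\<^sub>R y \<in> {-r..r}"
      using l by (intro convexD[OF convex_real_interval(5)]) auto
    moreover have "exp (- x\<^sup>2 / 2) powr l * exp (- y\<^sup>2 / 2) powr (1 - l) = exp (- (l * x\<^sup>2 + (1 - l) * y\<^sup>2) / 2)"
      by (simp add: powr_def exp_add[symmetric] field_simps)
    moreover have "(l * x + (1 - l) * y)\<^sup>2 \<le> l * x\<^sup>2 + (1 - l) * y\<^sup>2"
    proof -
      have "l * x\<^sup>2 + (1 - l) * y\<^sup>2 - (l * x + (1 - l) * y)\<^sup>2 = l * (1 - l) * (x - y)\<^sup>2"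
        by (simp add: power2_eq_square algebra_simps)
      also have "\<dots> \<ge> 0" using l by simp
      finally show ?thesis by simp
    qed
    ultimately show ?thesis using True by (simp add: trunc_gauss_def)
  qed (auto simp: trunc_gauss_def indicator_def)
qed measurable

lemma nn_integral_trunc_gauss:
  "(\<integral>\<^sup>+t. ennreal (trunc_gauss r t) \<partial>lborel) = ennreal (trunc_mass r)"
proof -
  have "(\<integral>\<^sup>+t. ennreal (trunc_gauss r t) \<partial>lborel) \<le> (\<integral>\<^sup>+t. indicator {-r..r} t \<partial>lborel)"
    by (intro nn_integral_mono) (auto simp: trunc_gauss_def indicator_def)
  also have "\<dots> < \<infinity>" using emeasure_lborel_cbox_finite[of "-r" r] by simp
  finally show ?thesis unfolding trunc_mass_def by simp
qed

lemma trunc_mass_pos: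
  assumes "0 < r" shows "0 < trunc_mass r"
proof -
  \<comment> \<open>The length of the interval times the minimum of the Gaussian on it, attained at
    the end points.\<close>
  have "0 < ennreal (2 * r * exp (- r\<^sup>2 / 2))" using assms by simp
  also have "\<dots> = (\<integral>\<^sup>+t. ennreal (exp (- r\<^sup>2 / 2)) * indicator {-r..r} t \<partial>lborel)"
    using assms by (subst nn_integral_cmult_indicator) (simp_all add: ennreal_mult[symmetric] mult_ac)
  also have "\<dots> \<le> (\<integral>\<^sup>+t. ennreal (trunc_gauss r t) \<partial>lborel)"
    using assms by (intro nn_integral_mono) (auto simp: trunc_gauss_def indicator_def abs_le_square_iff[symmetric])
  finally show ?thesis by (simp add: nn_integral_trunc_gauss)
qed

lemma trunc_mass_mono:
  assumes "r \<le> s" shows "trunc_mass r \<le> trunc_mass s"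
proof -
  have "(\<integral>\<^sup>+t. ennreal (trunc_gauss r t) \<partial>lborel) \<le> (\<integral>\<^sup>+t. ennreal (trunc_gauss s t) \<partial>lborel)"
    using assms by (intro nn_integral_mono ennreal_leI) (auto simp: trunc_gauss_def indicator_def)
  moreover have "0 \<le> trunc_mass s" by (simp add: trunc_mass_def)
  ultimately show ?thesis by (simp add: nn_integral_trunc_gauss)
qed

lemma even_log_concave_norm_gauss: "even_log_concave (norm_gauss r)"
proof -
  have "linear (\<lambda>t. trunc_mass r * t)" by (simp add: linear_iff algebra_simps)
  from even_log_concave_linear[OF even_log_concave_trunc_gauss this]
  show ?thesis by (simp add: norm_gauss_def[abs_def])
qed

lemma nn_integral_norm_gauss:
  assumes "0 < r" shows "(\<integral>\<^sup>+t. ennreal (norm_gauss r t) \<partial>lborel) = 1"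
proof -
  note m = trunc_mass_pos[OF assms]
  have "ennreal (trunc_mass r) = ennreal (trunc_mass r) * (\<integral>\<^sup>+t. ennreal (norm_gauss r t) \<partial>lborel)"
    using nn_integral_real_affine[of "\<lambda>t. ennreal (trunc_gauss r t)" "trunc_mass r" 0] m
    by (simp add: nn_integral_trunc_gauss norm_gauss_def)
  then have "ennreal (trunc_mass r) * 1 = ennreal (trunc_mass r) * (\<integral>\<^sup>+t. ennreal (norm_gauss r t) \<partial>lborel)"
    by simp
  then show ?thesis using m by (subst (asm) ennreal_mult_cancel_left) auto
qed

text \<open>Both integrals are 1. As \<open>trunc_mass r \<le> trunc_mass s\<close>, the rescaled
  Gaussian for \<open>s\<close> decays at least as fast, so it stays below the one for
  \<open>r\<close> on the support of the latter.\<close>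

lemma more_peaked_norm_gauss:
  assumes r: "0 < r" "r \<le> s"
  shows "more_peaked (\<lambda>t. ennreal (norm_gauss r t)) (\<lambda>t. ennreal (norm_gauss s t))"
  unfolding more_peaked_def
proof (intro conjI)
  have s: "0 < s" using r by simp
  show "(\<lambda>t. ennreal (norm_gauss r t)) \<in> borel_measurable borel"
    "(\<lambda>t. ennreal (norm_gauss s t)) \<in> borel_measurable borel"
    using even_log_concaveD(1)[OF even_log_concave_norm_gauss] by auto
  show "(\<integral>\<^sup>+t. ennreal (norm_gauss s t) \<partial>lborel) \<le> (\<integral>\<^sup>+t. ennreal (norm_gauss r t) \<partial>lborel)"
    "(\<integral>\<^sup>+t. ennreal (norm_gauss s t) \<partial>lborel) < \<infinity>"
    using r s by (simp_all add: nn_integral_norm_gauss)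
  note m = trunc_mass_pos[OF r(1)] trunc_mass_mono[OF r(2)]
  show "\<exists>c\<ge>0. (\<forall>t. \<bar>t\<bar> \<le> c \<longrightarrow> ennreal (norm_gauss s t) \<le> ennreal (norm_gauss r t)) \<and>
      (\<forall>t. c < \<bar>t\<bar> \<longrightarrow> ennreal (norm_gauss r t) = 0)"
  \<comment> \<open>The crossing point is the end of the support of
    \<open>norm_gauss r\<close>.\<close>
  proof (intro exI[of _ "r / trunc_mass r"] conjI allI impI)
    fix t assume "\<bar>t\<bar> \<le> r / trunc_mass r"
    then have "\<bar>trunc_mass r * t\<bar> \<le> r" using m by (simp add: abs_mult field_simps)
    then have "trunc_mass r * t \<in> {-r..r}" by auto
    then have "norm_gauss r t = exp (- (trunc_mass r * t)\<^sup>2 / 2)"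
      by (simp add: norm_gauss_def trunc_gauss_def)
    moreover have "\<bar>trunc_mass r * t\<bar> \<le> \<bar>trunc_mass s * t\<bar>"
      using m by (auto simp: abs_mult intro!: mult_right_mono)
    then have "(trunc_mass r * t)\<^sup>2 \<le> (trunc_mass s * t)\<^sup>2" by (simp only: abs_le_square_iff)
    then have "norm_gauss s t \<le> exp (- (trunc_mass r * t)\<^sup>2 / 2)"
      by (auto simp: norm_gauss_def trunc_gauss_def indicator_def)
    ultimately show "ennreal (norm_gauss s t) \<le> ennreal (norm_gauss r t)" by (intro ennreal_leI) simp
  next
    fix t assume "r / trunc_mass r < \<bar>t\<bar>"
    then have "r < \<bar>trunc_mass r * t\<bar>" using m by (simp add: abs_mult field_simps)
    then show "ennreal (norm_gauss r t) = 0"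
      by (auto simp: norm_gauss_def trunc_gauss_def indicator_def)
  qed (use m r in simp)
qed

lemma nn_integral_lborel_scale:
  fixes f :: "'a::euclidean_space \<Rightarrow> ennreal"
  assumes f[measurable]: "f \<in> borel_measurable borel" and c: "0 < c"
  shows "(\<integral>\<^sup>+x. f x \<partial>lborel) = ennreal (c ^ DIM('a)) * (\<integral>\<^sup>+x. f (c *\<^sub>R x) \<partial>lborel)"
  using c by (subst lborel_affine[of c 0])
    (simp_all add: nn_integral_density nn_integral_distr nn_integral_cmult)

text \<open>The hypothesis \<open>frame\<close> makes the \<open>a j\<close> a Parseval frame, so
  the Gaussian density splits into one factor for each slab. Scaling the variable by
  \<open>trunc_mass r\<close> normalizes the factors and produces the power in front, which depends
  on the dimension but not on the frame.\<close>

lemma emeasure_std_gaussian_slabs: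
  fixes a :: "'i \<Rightarrow> 'a::euclidean_space"
  assumes J: "finite J" and frame: "\<And>x. (\<Sum>j\<in>J. (a j \<bullet> x)\<^sup>2) = (norm x)\<^sup>2" and r: "0 < r"
  shows "emeasure std_gaussian {x. \<forall>j\<in>J. \<bar>a j \<bullet> x\<bar> \<le> r}
    = ennreal ((trunc_mass r / sqrt (2 * pi)) ^ DIM('a)) * (\<integral>\<^sup>+x. ennreal (\<Prod>j\<in>J. norm_gauss r (a j \<bullet> x)) \<partial>lborel)"
proof -
  note m = trunc_mass_pos[OF r]
  let ?S = "{x. \<forall>j\<in>J. \<bar>a j \<bullet> x\<bar> \<le> r}" and ?d = "sqrt (2 * pi) ^ DIM('a)"
  have S: "?S \<in> sets borel"
  proof -
    have "?S = (\<Inter>j\<in>J. {x. \<bar>a j \<bullet> x\<bar> \<le> r})" by auto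
    moreover have "closed \<dots>"
      by (intro closed_INT ballI closed_Collect_le continuous_intros)
    ultimately show ?thesis by simp
  qed
  have prod: "exp (- (norm x)\<^sup>2 / 2) * indicator ?S x = (\<Prod>j\<in>J. trunc_gauss r (a j \<bullet> x))" for x
  proof -
    have "- (norm x)\<^sup>2 / 2 = (\<Sum>j\<in>J. - (a j \<bullet> x)\<^sup>2 / 2)"
      unfolding frame[symmetric] by (simp add: sum_negf sum_divide_distrib)
    then have "exp (- (norm x)\<^sup>2 / 2) = (\<Prod>j\<in>J. exp (- (a j \<bullet> x)\<^sup>2 / 2))"
      by (simp only: exp_sum[OF J])
    moreover have "indicator ?S x = (\<Prod>j\<in>J. indicator {-r..r} (a j \<bullet> x) :: real)"
    proof (cases "x \<in> ?S")
      case True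
      then have "(\<Prod>j\<in>J. indicator {-r..r} (a j \<bullet> x) :: real) = 1"
        by (intro prod.neutral) (auto simp: abs_le_iff)
      then show ?thesis using True by simp
    next
      case False
      then obtain j where "j \<in> J" "\<not> \<bar>a j \<bullet> x\<bar> \<le> r" by auto
      then have "j \<in> J" "a j \<bullet> x \<notin> {-r..r}" by auto
      then have "(\<Prod>j\<in>J. indicator {-r..r} (a j \<bullet> x) :: real) = 0"
        using J by (intro prod_zero) (auto intro!: bexI[of _ j])
      then show ?thesis using False by simp
    qed
    ultimately show ?thesis by (simp only: trunc_gauss_def prod.distrib)
  qed
  have "emeasure std_gaussian ?S = (\<integral>\<^sup>+x. ennreal (exp (- (norm x)\<^sup>2 / 2) / ?d) * indicator ?S x \<partial>lborel)"
    unfolding std_gaussian_def using S by (subst emeasure_density) auto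
  also have "\<dots> = (\<integral>\<^sup>+x. ennreal (1 / ?d) * ennreal (\<Prod>j\<in>J. trunc_gauss r (a j \<bullet> x)) \<partial>lborel)"
    unfolding prod[symmetric]
    by (intro nn_integral_cong) (auto simp: indicator_def ennreal_mult[symmetric])
  also have "\<dots> = ennreal (1 / ?d) * (\<integral>\<^sup>+x. ennreal (\<Prod>j\<in>J. trunc_gauss r (a j \<bullet> x)) \<partial>lborel)"
    by (rule nn_integral_cmult) measurable
  also have "(\<integral>\<^sup>+x. ennreal (\<Prod>j\<in>J. trunc_gauss r (a j \<bullet> x)) \<partial>lborel)
      = ennreal (trunc_mass r ^ DIM('a)) * (\<integral>\<^sup>+x. ennreal (\<Prod>j\<in>J. norm_gauss r (a j \<bullet> x)) \<partial>lborel)"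
    by (subst nn_integral_lborel_scale[OF _ m]) (simp_all add: norm_gauss_def)
  also have "ennreal (1 / ?d) * (ennreal (trunc_mass r ^ DIM('a)) * (\<integral>\<^sup>+x. ennreal (\<Prod>j\<in>J. norm_gauss r (a j \<bullet> x)) \<partial>lborel))
     = ennreal ((trunc_mass r / sqrt (2 * pi)) ^ DIM('a)) * (\<integral>\<^sup>+x. ennreal (\<Prod>j\<in>J. norm_gauss r (a j \<bullet> x)) \<partial>lborel)"
    using m by (simp add: mult.assoc[symmetric] ennreal_mult[symmetric] power_divide)
  finally show ?thesis .
qed

section \<open>Cubes and their sections by subspaces\<close>

lemma scale_inf_ball:
  assumes "0 < r" shows "(*\<^sub>R) r ` inf_ball = {x. \<forall>i. \<bar>x $ i\<bar> \<le> r}"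
proof (intro equalityI subsetI)
  fix x :: "real ^ 'n" assume "x \<in> {x. \<forall>i. \<bar>x $ i\<bar> \<le> r}"
  then have "\<bar>x $ i / r\<bar> \<le> 1" for i
    using assms by (simp add: abs_divide)
  then have "(1 / r) *\<^sub>R x \<in> inf_ball"
    unfolding abs_le_iff by (simp add: inf_ball_def minus_le_iff)
  moreover have "x = r *\<^sub>R ((1 / r) *\<^sub>R x)" using assms by simp
  ultimately show "x \<in> (*\<^sub>R) r ` inf_ball" by blast
next
  fix x :: "real ^ 'n" assume "x \<in> (*\<^sub>R) r ` inf_ball"
  then obtain y :: "real ^ 'n" where y: "x = r *\<^sub>R y" "y \<in> inf_ball" by auto
  have "\<bar>y $ i\<bar> \<le> 1" for i
    using y(2) unfolding abs_le_iff by (simp add: inf_ball_def minus_le_iff)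
  then show "x \<in> {x. \<forall>i. \<bar>x $ i\<bar> \<le> r}"
    using assms by (simp add: y(1) abs_mult mult_left_le)
qed

text \<open>For the frame \<open>Basis\<close> the normalized integral is a product of ones. The
  denominator of the quotient is thus exactly the factor in front in
  \<open>emeasure_std_gaussian_slabs\<close>.\<close>

lemma measure_std_gaussian_inf_ball:
  assumes r: "0 < r"
  shows "measure std_gaussian ((*\<^sub>R) r ` (inf_ball :: (real ^ 'k) set)) = (trunc_mass r / sqrt (2 * pi)) ^ CARD('k)"
proof -
  have [measurable]: "norm_gauss r \<in> borel_measurable borel"
    using even_log_concaveD(1)[OF even_log_concave_norm_gauss] .
  have nonneg: "0 \<le> norm_gauss r t" for t using even_log_concaveD(2)[OF even_log_concave_norm_gauss] .
  have "(*\<^sub>R) r ` (inf_ball :: (real ^ 'k) set) = {x. \<forall>b\<in>Basis. \<bar>b \<bullet> x\<bar> \<le> r}"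
    unfolding scale_inf_ball[OF r] by (auto simp: Basis_vec_def inner_axis' )
  moreover have "(\<Sum>b\<in>Basis. (b \<bullet> x)\<^sup>2) = (norm x)\<^sup>2" for x :: "real ^ 'k"
    unfolding power2_norm_eq_inner by (subst euclidean_inner) (simp add: power2_eq_square inner_commute)
  moreover have "(\<integral>\<^sup>+x. ennreal (\<Prod>b\<in>(Basis :: (real ^ 'k) set). norm_gauss r (b \<bullet> x)) \<partial>lborel) = 1"
  proof -
    have "(\<integral>\<^sup>+x. ennreal (\<Prod>b\<in>(Basis :: (real ^ 'k) set). norm_gauss r (b \<bullet> x)) \<partial>lborel)
      = (\<integral>\<^sup>+x. (\<Prod>b\<in>(Basis :: (real ^ 'k) set). ennreal (norm_gauss r (x \<bullet> b))) \<partial>lborel)"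
      by (simp add: prod_ennreal nonneg inner_commute)
    also have "\<dots> = (\<Prod>b\<in>(Basis :: (real ^ 'k) set). (\<integral>\<^sup>+t. ennreal (norm_gauss r t) \<partial>lborel))"
      by (rule nn_integral_lborel_prod) auto
    finally show ?thesis by (simp add: nn_integral_norm_gauss[OF r])
  qed
  ultimately have "emeasure std_gaussian ((*\<^sub>R) r ` (inf_ball :: (real ^ 'k) set))
      = ennreal ((trunc_mass r / sqrt (2 * pi)) ^ CARD('k))"
    using emeasure_std_gaussian_slabs[of "Basis :: (real ^ 'k) set" "\<lambda>b. b" r] r by simp
  then show ?thesis
    using trunc_mass_pos[OF r] by (simp add: measure_def)
qed

text \<open>An isometry of \<open>real ^ 'k\<close> onto \<open>E\<close> transports the Gaussian
  measure, and the coordinate functionals on \<open>E\<close> become inner products with a Parseval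
  frame.\<close>

lemma subspace_gaussian_slabs:
  fixes E :: "(real ^ 'n) set"
  assumes "subspace E" and "dim E = CARD('k)"
  obtains a :: "'n \<Rightarrow> real ^ 'k" where
    "\<And>x. (\<Sum>i\<in>UNIV. (a i \<bullet> x)\<^sup>2) = (norm x)\<^sup>2"
    "\<And>r. 0 < r \<Longrightarrow> emeasure (subspace_gaussian E) (E \<inter> (*\<^sub>R) r ` inf_ball)
      = emeasure std_gaussian {x. \<forall>i\<in>UNIV. \<bar>a i \<bullet> x\<bar> \<le> r}"
    "prob_space (subspace_gaussian E)" "measure (subspace_gaussian E) E = 1"
proof -
  obtain f :: "real ^ 'k \<Rightarrow> real ^ 'n" where f: "linear f" "range f = E" "\<And>x. norm (f x) = norm x"
    using isometry_subspaces[of "UNIV :: (real ^ 'k) set" E] assms by auto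
  have fm: "f \<in> borel_measurable borel" by (rule borel_measurable_linear[OF f(1)])
  note distr = subspace_gaussian_eq_distr[OF f(1,3,2)]
  \<comment> \<open>Through the isometry \<open>f\<close>, the vector \<open>a i\<close> corresponds
    to the orthogonal projection of the standard basis vector to \<open>E\<close>.\<close>
  define a where "a i = adjoint f (axis i 1)" for i
  have a: "a i \<bullet> x = f x $ i" for i x
    using adjoint_works[OF f(1), of x "axis i 1"] by (simp add: a_def inner_axis inner_commute)
  have sg: "space (std_gaussian :: (real ^ 'k) measure) = UNIV"
    "sets (std_gaussian :: (real ^ 'k) measure) = sets borel"
    by (simp_all add: std_gaussian_def)
  show thesis
  proof
    show "(\<Sum>i\<in>UNIV. (a i \<bullet> x)\<^sup>2) = (norm x)\<^sup>2" for x
      unfolding a f(3)[of x, symmetric] power2_norm_eq_inner by (simp add: inner_vec_def power2_eq_square)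
    interpret prob_space "std_gaussian :: (real ^ 'k) measure" by (rule prob_space_std_gaussian)
    show "prob_space (subspace_gaussian E)"
      unfolding distr by (rule prob_space_distr) (use fm sg in \<open>simp cong: measurable_cong_sets\<close>)
    have "emeasure (subspace_gaussian E) E = emeasure std_gaussian (f -` E \<inter> space std_gaussian)"
      unfolding distr using fm sg closed_subspace[OF assms(1)]
      by (intro emeasure_distr) (auto cong: measurable_cong_sets)
    also have "f -` E \<inter> space std_gaussian = space std_gaussian" using f(2) by auto
    finally show "measure (subspace_gaussian E) E = 1" by (simp add: measure_def emeasure_space_1)
    fix r :: real assume r: "0 < r"
    have "closed ((*\<^sub>R) r ` (inf_ball :: (real ^ 'n) set))"
      unfolding scale_inf_ball[OF r] by (intro closed_Collect_all closed_Collect_le continuous_intros)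
    then have "closed (E \<inter> (*\<^sub>R) r ` inf_ball)"
      using closed_subspace[OF assms(1)] by (intro closed_Int)
    then have "emeasure (subspace_gaussian E) (E \<inter> (*\<^sub>R) r ` inf_ball)
        = emeasure std_gaussian (f -` (E \<inter> (*\<^sub>R) r ` inf_ball) \<inter> space std_gaussian)"
      unfolding distr using fm sg by (intro emeasure_distr) (auto cong: measurable_cong_sets)
    also have "f -` (E \<inter> (*\<^sub>R) r ` inf_ball) \<inter> space std_gaussian = {x. \<forall>i\<in>UNIV. \<bar>a i \<bullet> x\<bar> \<le> r}"
      using f(2) by (auto simp: scale_inf_ball[OF r] a sg)
    finally show "emeasure (subspace_gaussian E) (E \<inter> (*\<^sub>R) r ` inf_ball)
      = emeasure std_gaussian {x. \<forall>i\<in>UNIV. \<bar>a i \<bullet> x\<bar> \<le> r}" .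
  qed
qed

section \<open>Monotonicity of the quotient and its limit at infinity\<close>

theorem theorem9:
  fixes E :: "(real ^ 'n) set"
  assumes "subspace E" and "dim E = CARD('k)"
  shows "antimono_on {0<..}
           (\<lambda>r. measure (subspace_gaussian E) (E \<inter> (*\<^sub>R) r ` (inf_ball :: (real ^ 'n) set)) /
                measure std_gaussian ((*\<^sub>R) r ` (inf_ball :: (real ^ 'k) set)))
         \<and> (\<forall>r>0. measure (subspace_gaussian E) (E \<inter> (*\<^sub>R) r ` (inf_ball :: (real ^ 'n) set)) \<ge>
                  measure std_gaussian ((*\<^sub>R) r ` (inf_ball :: (real ^ 'k) set)))"
proof -
  obtain a :: "'n \<Rightarrow> real ^ 'k" where
    frame: "(\<Sum>i\<in>UNIV. (a i \<bullet> x)\<^sup>2) = (norm x)\<^sup>2" and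
    slabs: "0 < r \<Longrightarrow> emeasure (subspace_gaussian E) (E \<inter> (*\<^sub>R) r ` inf_ball)
      = emeasure std_gaussian {x. \<forall>i\<in>UNIV. \<bar>a i \<bullet> x\<bar> \<le> r}" and
    prob: "prob_space (subspace_gaussian E)" and total: "measure (subspace_gaussian E) E = 1" for x r
    using subspace_gaussian_slabs[OF assms] by blast
  interpret E: prob_space "subspace_gaussian E" by (rule prob)
  interpret K: prob_space "std_gaussian :: (real ^ 'k) measure" by (rule prob_space_std_gaussian)
  let ?E = "\<lambda>r. measure (subspace_gaussian E) (E \<inter> (*\<^sub>R) r ` (inf_ball :: (real ^ 'n) set))"
  let ?K = "\<lambda>r. measure std_gaussian ((*\<^sub>R) r ` (inf_ball :: (real ^ 'k) set))"
  \<comment> \<open>The quotient itself, in the form in which the factors can be exchanged; the fact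
    \<open>R\<close> below identifies the two.\<close>
  define R where "R r = (\<integral>\<^sup>+x. ennreal (\<Prod>i\<in>UNIV. norm_gauss r (a i \<bullet> x)) \<partial>lborel)" for r
  have K_pos: "0 < ?K r" if "0 < r" for r
    using trunc_mass_pos[OF that] by (simp add: measure_std_gaussian_inf_ball[OF that])
  have E_eq: "ennreal (?E r) = ennreal (?K r) * R r" if "0 < r" for r
    using slabs[OF that] emeasure_std_gaussian_slabs[of UNIV a, OF _ frame that]
    by (simp add: R_def measure_std_gaussian_inf_ball[OF that] E.emeasure_eq_measure)
  have R: "R r = ennreal (?E r / ?K r)" if "0 < r" for r
  proof -
    have "ennreal (?K r) * R r = ennreal (?K r) * ennreal (?E r / ?K r)"
      using K_pos[OF that] by (simp add: E_eq[OF that, symmetric] ennreal_mult[symmetric])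
    then show ?thesis
      using K_pos[OF that] by (subst (asm) ennreal_mult_cancel_left) auto
  qed
  have anti: "?E s / ?K s \<le> ?E r / ?K r" if rs: "0 < r" "r \<le> s" for r s
  proof -
    \<comment> \<open>All factors for \<open>s\<close> are exchanged for factors for
      \<open>r\<close>, starting from the constant function 1.\<close>
    have "R s \<le> R r"
      unfolding R_def
      using nn_integral_more_peaked_prod[of UNIV "norm_gauss r" "norm_gauss s" "\<lambda>_. 1" a]
        more_peaked_norm_gauss[OF rs] even_log_concave_norm_gauss even_log_concave_1 by simp
    then show ?thesis
      using R[of r] R[of s] rs K_pos[of r] by (simp add: ennreal_le_iff)
  qed
  have "?K r \<le> ?E r" if r: "0 < r" for r
  proof -
    \<comment> \<open>These sections exhaust \<open>E\<close>, so their measures tend to 1. Starting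
      at \<open>r\<close> keeps all radii positive and at least \<open>r\<close>, as
      \<open>anti\<close> requires.\<close>
    define B where "B n = E \<inter> (*\<^sub>R) (r + real n) ` (inf_ball :: (real ^ 'n) set)" for n
    have B: "B n = {x\<in>E. \<forall>i. \<bar>x $ i\<bar> \<le> r + real n}" for n
      using r by (auto simp: B_def scale_inf_ball)
    have "closed (B n)" for n
      using closed_subspace[OF assms(1)] unfolding B
      by (intro closed_Collect_conj closed_Collect_all closed_Collect_le continuous_intros) simp
    then have "range B \<subseteq> sets (subspace_gaussian E)"
      by (auto simp: subspace_gaussian_def subspace_lborel_def Let_def)
    moreover have "incseq B" 
      unfolding incseq_def by (auto simp: B intro: order_trans[of _ "r + real m" "r + real n" for m n])
    ultimately have "(\<lambda>n. measure (subspace_gaussian E) (B n)) \<longlonglongrightarrow> measure (subspace_gaussian E) (\<Union>n. B n)"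
      by (rule E.finite_Lim_measure_incseq)
    moreover have "(\<Union>n. B n) = E"
    proof (intro equalityI subsetI)
      fix x assume x: "x \<in> E"
      obtain n :: nat where "norm x \<le> real n" using real_arch_simple by blast
      then have "\<bar>x $ i\<bar> \<le> r + real n" for i
        using component_le_norm_cart[of x i] r by linarith
      then show "x \<in> (\<Union>n. B n)" using x by (auto simp: B)
    qed (auto simp: B)
    moreover note total
    moreover have "measure (subspace_gaussian E) (B n) \<le> ?E r / ?K r" for n
    proof -
      \<comment> \<open>The denominator is a probability, so dividing by it can only increase the
        value; the quotient at \<open>r\<close> thus bounds all measures in the sequence and hence
        their limit 1.\<close>
      have "?E (r + real n) \<le> ?E (r + real n) / ?K (r + real n)"
        using K.prob_le_1 K_pos[of "r + real n"] r by (simp add: le_divide_eq mult_left_le)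
      also have "\<dots> \<le> ?E r / ?K r" using r by (intro anti) auto
      finally show ?thesis by (simp add: B_def)
    qed
    ultimately have "1 \<le> ?E r / ?K r"
      by (intro LIMSEQ_le_const2[of "\<lambda>n. measure (subspace_gaussian E) (B n)"]) auto
    then show ?thesis using K_pos[OF r] by simp
  qed
  then show ?thesis using anti by (auto simp: monotone_on_def)
qed

end
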